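(* Let $n>1$, let $u_1,\ldots,u_s$ be elements of the free group on $x_1,\ldots,x_n$, let $m_1,\ldots,m_s\ge 1$ be integers, and let $G$ be the group given by the presentation $$\langle x_1,\ldots,x_n \mid u_1^{m_1},\ldots,u_s^{m_s}\rangle .$$ If $G$ has infinite abelianisation and at least $s-n+2$ of the relators are such that their powers $m_i$ have a common factor greater than $1$ (i.e. there is an integer $q>1$ dividing $m_i$ for at least $s-n+2$ indices $i\in\{1,\ldots,s\}$), then $G$ is large.
   Context: A finitely generated group is large if it has a finite index subgroup that surjects onto the non-abelian free group of rank $2$. The abelianisation of $G$ is $G/[G,G]$. *)

theory Defs
  imports "HOL-Algebra.Algebra"
begin

section \<open>Free groups as groups of reduced words\<close>

text \<open>The letter \<open>(x, True)\<close> is the generator \<open>x\<close>, and \<open>(x, False)\<close> is its formal inverse.\<close>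

type_synonym 'a letter = "'a \<times> bool"

fun flip :: "'a letter \<Rightarrow> 'a letter" where
  "flip (x, b) = (x, \<not> b)"

definition reduced :: "'a letter list \<Rightarrow> bool" where
  "reduced = successively (\<lambda>a b. b \<noteq> flip a)"

text \<open>\<open>cancel_Cons a w\<close> is the reduced form of \<open>a # w\<close> if \<open>w\<close> is reduced.\<close>

fun cancel_Cons :: "'a letter \<Rightarrow> 'a letter list \<Rightarrow> 'a letter list" where
  "cancel_Cons a [] = [a]"
| "cancel_Cons a (b # w) = (if b = flip a then w else a # b # w)"

definition free_group :: "'a set \<Rightarrow> 'a letter list monoid" where
  "free_group A =
    \<lparr>carrier = {w. reduced w \<and> fst ` set w \<subseteq> A},
     monoid.mult = (\<lambda>v w. foldr cancel_Cons v w),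
     one = []\<rparr>"

lemma flip_flip [simp]: "flip (flip a) = a"
  by (cases a) auto

lemma fst_flip [simp]: "fst (flip a) = fst a"
  by (cases a) auto

lemma flip_neq [simp]: "flip a \<noteq> a" "a \<noteq> flip a"
  by (cases a; simp)+

lemma flip_eq_iff: "flip a = b \<longleftrightarrow> a = flip b"
  by (metis flip_flip)

lemma reduced_Nil [simp]: "reduced []"
  by (simp add: reduced_def)

lemma reduced_Cons_Cons [simp]: "reduced (a # b # w) \<longleftrightarrow> b \<noteq> flip a \<and> reduced (b # w)"
  by (simp add: reduced_def)

lemma reduced_single [simp]: "reduced [a]"
  by (simp add: reduced_def)

lemma reduced_ConsD: "reduced (a # w) \<Longrightarrow> reduced w"
  by (cases w) auto

lemma reduced_cancel_Cons [simp]: "reduced w \<Longrightarrow> reduced (cancel_Cons a w)"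
  by (cases w) (auto dest: reduced_ConsD)

lemma cancel_Cons_flip [simp]:
  assumes "reduced w"
  shows "cancel_Cons (flip a) (cancel_Cons a w) = w" "cancel_Cons a (cancel_Cons (flip a) w) = w"
proof -
  have *: "cancel_Cons (flip b) (cancel_Cons b w) = w" for b
  proof (cases w)
    case (Cons c v)
    then show ?thesis using assms by (cases v) auto
  qed auto
  show "cancel_Cons (flip a) (cancel_Cons a w) = w" "cancel_Cons a (cancel_Cons (flip a) w) = w"
    using *[of a] *[of "flip a"] by auto
qed

lemma cancel_Cons_reduced: "reduced (a # w) \<Longrightarrow> cancel_Cons a w = a # w"
  by (cases w) auto

lemma reduced_foldr: "reduced w \<Longrightarrow> reduced (foldr cancel_Cons v w)"
  by (induction v) auto

lemma set_cancel_Cons: "set (cancel_Cons a w) \<subseteq> insert a (set w)"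
  by (cases w) auto

lemma set_foldr_cancel_Cons: "set (foldr cancel_Cons v w) \<subseteq> set v \<union> set w"
  by (induction v) (use set_cancel_Cons in fastforce)+

lemma foldr_cancel_Cons_cancel_Cons:
  assumes "reduced w"
  shows "foldr cancel_Cons (cancel_Cons a v) w = cancel_Cons a (foldr cancel_Cons v w)"
proof (cases v)
  case (Cons b v')
  have "reduced (foldr cancel_Cons v' w)" using assms by (rule reduced_foldr)
  with Cons show ?thesis by auto
qed auto

lemma foldr_cancel_Cons_assoc:
  assumes "reduced w"
  shows "foldr cancel_Cons (foldr cancel_Cons u v) w =
    foldr cancel_Cons u (foldr cancel_Cons v w)"
  by (induction u) (simp_all add: foldr_cancel_Cons_cancel_Cons assms)

lemma foldr_cancel_Cons_Nil: "reduced v \<Longrightarrow> foldr cancel_Cons v [] = v"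
  by (induction v) (simp_all add: reduced_ConsD cancel_Cons_reduced)

lemma reduced_inverse: "reduced w \<Longrightarrow> reduced (rev (map flip w))"
  unfolding reduced_def successively_rev successively_map
  by (erule successively_mono) (auto simp: flip_eq_iff)

lemma foldr_cancel_Cons_inverse: "foldr cancel_Cons (rev (map flip w)) w = []"
  by (induction w) auto

lemma group_free_group: "group (free_group A)"
proof (rule groupI)
  fix u v assume u: "u \<in> carrier (free_group A)" and v: "v \<in> carrier (free_group A)"
  have "fst ` set (foldr cancel_Cons u v) \<subseteq> fst ` (set u \<union> set v)"
    by (intro image_mono set_foldr_cancel_Cons)
  with u v have "fst ` set (foldr cancel_Cons u v) \<subseteq> A"
    unfolding free_group_def image_Un by simp blast
  with u v show "u \<otimes>\<^bsub>free_group A\<^esub> v \<in> carrier (free_group A)"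
    by (simp add: free_group_def reduced_foldr)
next
  fix w assume "w \<in> carrier (free_group A)"
  then have "rev (map flip w) \<in> carrier (free_group A)"
    and "rev (map flip w) \<otimes>\<^bsub>free_group A\<^esub> w = \<one>\<^bsub>free_group A\<^esub>"
    by (auto simp: free_group_def reduced_inverse foldr_cancel_Cons_inverse image_image)
  then show "\<exists>v\<in>carrier (free_group A). v \<otimes>\<^bsub>free_group A\<^esub> w = \<one>\<^bsub>free_group A\<^esub>" by blast
qed (auto simp: free_group_def foldr_cancel_Cons_assoc)


section \<open>Presentations, abelianisation and largeness\<close>

definition normal_closure :: "('a, 'b) monoid_scheme \<Rightarrow> 'a set \<Rightarrow> 'a set" where
  "normal_closure G R = generate G (\<Union>g\<in>carrier G. \<Union>r\<in>R. {g \<otimes>\<^bsub>G\<^esub> r \<otimes>\<^bsub>G\<^esub> inv\<^bsub>G\<^esub> g})"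

lemma (in group) normal_closure_normal:
  assumes "R \<subseteq> carrier G"
  shows "normal_closure G R \<lhd> G"
  unfolding normal_closure_def
proof (rule normal_generateI)
  fix h g
  assume "h \<in> (\<Union>g\<in>carrier G. \<Union>r\<in>R. {g \<otimes> r \<otimes> inv g})" and g: "g \<in> carrier G"
  then obtain k r where k: "k \<in> carrier G" and r: "r \<in> R" and h: "h = k \<otimes> r \<otimes> inv k"
    by blast
  have "r \<in> carrier G" using r assms by blast
  then have "g \<otimes> h \<otimes> inv g = (g \<otimes> k) \<otimes> r \<otimes> inv (g \<otimes> k)"
    using g k by (simp add: h m_assoc inv_mult_group)
  then show "g \<otimes> h \<otimes> inv g \<in> (\<Union>g\<in>carrier G. \<Union>r\<in>R. {g \<otimes> r \<otimes> inv g})"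
    using g k r by blast
qed (use assms in auto)

definition presented_group :: "'a set \<Rightarrow> 'a letter list set \<Rightarrow> 'a letter list set monoid" where
  "presented_group A R = free_group A Mod normal_closure (free_group A) R"

lemma group_presented_group:
  "R \<subseteq> carrier (free_group A) \<Longrightarrow> group (presented_group A R)"
  unfolding presented_group_def
  by (intro normal.factorgroup_is_group group.normal_closure_normal group_free_group)

definition abelianisation :: "('a, 'b) monoid_scheme \<Rightarrow> 'a set monoid" where
  "abelianisation G = G Mod derived G (carrier G)"

definition finitely_generated_group :: "('a, 'b) monoid_scheme \<Rightarrow> bool" where
  "finitely_generated_group G \<longleftrightarrow>
    group G \<and> (\<exists>S. finite S \<and> S \<subseteq> carrier G \<and> generate G S = carrier G)"

definition large_group :: "('a, 'b) monoid_scheme \<Rightarrow> bool" where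
  "large_group G \<longleftrightarrow> finitely_generated_group G \<and>
    (\<exists>H. subgroup H G \<and> finite (rcosets\<^bsub>G\<^esub> H) \<and>
      epi (G\<lparr>carrier := H\<rparr>) (free_group {1, 2 :: nat}) \<noteq> {})"

end

theory Submission
  imports Defs
begin

text \<open>Let \<open>G\<close> be the presented group.  Its infinite abelianisation provides a homomorphism \<open>\<chi>\<close> from
  \<open>G\<close> onto the integers (\<open>infinite_abelianisation_imp_weight\<close>, \<open>exists_primitive_weight\<close>).  It
  kills every \<open>u\<^sub>i\<close>, since it kills a power of \<open>u\<^sub>i\<close>.

  A derivation \<open>D\<close> of the free group along \<open>\<chi>\<close>, with values in the Laurent polynomials, is given by
  its \<open>n\<close> values on the generators.  From \<open>\<chi> u = 0\<close> it follows that \<open>D (u\<^sup>m) = m * D u\<close>, so the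
  relators \<open>u\<^sup>m\<close> with \<open>q dvd m\<close> impose no condition modulo \<open>q\<close>.  At most \<open>n - 2\<close> linear conditions
  \<open>D u = 0\<close> remain.  The further condition \<open>D t = 0\<close> for one element \<open>t\<close> with \<open>\<chi> t = 1\<close> leaves fewer
  conditions than unknowns, hence some \<open>D\<close> that does not vanish modulo \<open>q\<close>
  (\<open>exists_lamp_function\<close>).  It amounts to a homomorphism from \<open>G\<close> to the lamplighter group over the
  integers modulo \<open>q\<close>: a word moves a walker on the integers by \<open>\<chi>\<close> and switches lamps by \<open>D\<close>.

  The lamplighter group is a limit of virtually free groups, and a homomorphism to it from a group
  with finitely many relators already lifts to one of these.  The proof makes this explicit and
  wraps the integers around a cycle of large length \<open>N\<close>.  At position \<open>k\<close>, the letter \<open>x\<^sub>i\<close> adds a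
  coefficient \<open>\<phi> i k\<close> of \<open>D x\<^sub>i\<close> to the lamp total \<open>c\<close> modulo \<open>q\<close>; for a word read from a given
  position, these contributions sum to one coefficient of its derivation, the state of a single lamp.  The
  nonzero \<open>\<phi> i k\<close> sit in the middle of \<open>{0..<N}\<close>, far from the seam between \<open>N - 1\<close> and \<open>0\<close>, and a
  step across the seam carries a label \<open>T c\<close> in the free group of rank 2.  Every \<open>u\<^sub>i\<close>, read from any
  position, is too short to meet both the seam and a nonzero \<open>\<phi>\<close> (\<open>short_word\<close>).  If it meets a
  nonzero \<open>\<phi>\<close>, its power in the presentation restores \<open>c\<close> because \<open>D\<close> vanishes on the relator modulo
  \<open>q\<close>; if it meets the seam, \<open>c\<close> is constant and the labels cancel because \<open>\<chi>\<close> vanishes on \<open>u\<^sub>i\<close>.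
  So \<open>G\<close> acts on a finite set with labels, and the stabiliser of a point maps to the free group
  (\<open>labelled_action_imp_virtually_onto_free\<close>).  This map is onto: \<open>t\<^sup>N\<close> goes once around the cycle
  with label \<open>T 0\<close>, and after a detour that changes the lamp total it does so with label \<open>T c\<close> for
  some \<open>c \<noteq> 0\<close> (\<open>label_loops\<close>).\<close>


section \<open>Words and their weights\<close>

lemma mult_free_group: "v \<otimes>\<^bsub>free_group A\<^esub> w = foldr cancel_Cons v w"
  by (simp add: free_group_def)

lemma one_free_group: "\<one>\<^bsub>free_group A\<^esub> = []"
  by (simp add: free_group_def)

lemma carrier_free_group: "w \<in> carrier (free_group A) \<longleftrightarrow> reduced w \<and> fst ` set w \<subseteq> A"
  by (simp add: free_group_def)

lemma letter_in_free_group: "fst a \<in> A \<Longrightarrow> [a] \<in> carrier (free_group A)"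
  by (simp add: carrier_free_group)

lemma Cons_free_group:
  assumes "a # w \<in> carrier (free_group A)"
  shows "w \<in> carrier (free_group A)" "a # w = [a] \<otimes>\<^bsub>free_group A\<^esub> w" "fst a \<in> A"
  using assms by (auto simp: carrier_free_group mult_free_group cancel_Cons_reduced dest: reduced_ConsD)

lemma inv_letter_free_group:
  assumes "i \<in> A"
  shows "inv\<^bsub>free_group A\<^esub> [(i, b)] = [(i, \<not> b)]"
  by (rule group.inv_equality[OF group_free_group])
    (use assms in \<open>auto simp: carrier_free_group mult_free_group one_free_group\<close>)

text \<open>A reduced word is the product of its letters, so membership of its image can be checked on the
  generators.\<close>
lemma free_group_subset:
  assumes H: "subgroup H G" and h: "h \<in> hom (free_group A) G"
    and gen: "\<And>i. i \<in> A \<Longrightarrow> h [(i, True)] \<in> H"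
    and G: "group G"
    and w: "w \<in> carrier (free_group A)"
  shows "h w \<in> H"
  using w
proof (induction w)
  case Nil
  then show ?case
    using hom_one[OF h group_free_group G] subgroup.one_closed[OF H] by (simp add: one_free_group)
next
  case (Cons a w)
  interpret group_hom "free_group A" G h
    using h G by (simp add: group_hom_def group_hom_axioms_def group_free_group)
  obtain i b where a: "a = (i, b)" by (cases a)
  have i: "i \<in> A" using Cons_free_group(3)[OF Cons.prems] a by simp
  have "h [(i, False)] = inv\<^bsub>G\<^esub> h [(i, True)]"
    using hom_inv[of "[(i, True)]"] i by (simp add: inv_letter_free_group letter_in_free_group)
  then have "h [a] \<in> H"
    using a gen[OF i] subgroup.m_inv_closed[OF H gen[OF i]] by (cases b) auto
  moreover have "h (a # w) = h [a] \<otimes>\<^bsub>G\<^esub> h w"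
    using Cons_free_group[OF Cons.prems] hom_mult[of "[a]" w] letter_in_free_group[of a A] by simp
  ultimately show ?case
    using Cons.IH Cons_free_group(1)[OF Cons.prems] subgroup.m_closed[OF H] by auto
qed

lemma subgroup_free_group_eq:
  assumes H: "subgroup H (free_group A)" and "\<And>i. i \<in> A \<Longrightarrow> [(i, True)] \<in> H"
  shows "H = carrier (free_group A)"
proof
  show "carrier (free_group A) \<subseteq> H"
  proof
    fix w assume w: "w \<in> carrier (free_group A)"
    have "id w \<in> H"
      by (rule free_group_subset[OF H _ _ group_free_group w])
        (use assms(2) in \<open>auto simp: hom_def\<close>)
    then show "w \<in> H" by simp
  qed
qed (rule subgroup.subset[OF H])

text \<open>The signed total of \<open>\<chi>\<close> over the letters of a word is the value of the homomorphism to the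
  integers that extends \<open>\<chi>\<close>.\<close>

definition weight :: "('a \<Rightarrow> int) \<Rightarrow> 'a letter list \<Rightarrow> int" where
  "weight \<chi> w = (\<Sum>(i, b)\<leftarrow>w. if b then \<chi> i else - \<chi> i)"

lemma weight_simps [simp]:
  "weight \<chi> [] = 0"
  "weight \<chi> ((i, b) # w) = (if b then \<chi> i else - \<chi> i) + weight \<chi> w"
  by (simp_all add: weight_def)

lemma weight_cancel_Cons: "weight \<chi> (cancel_Cons a w) = weight \<chi> [a] + weight \<chi> w"
  by (cases a; cases w) auto

lemma weight_mult: "weight \<chi> (foldr cancel_Cons v w) = weight \<chi> v + weight \<chi> w"
proof (induction v)
  case (Cons a v)
  then show ?case by (cases a) (simp add: weight_cancel_Cons)
qed simp

lemma weight_hom: "weight \<chi> \<in> hom (free_group A) integer_group"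
  by (auto simp: hom_def integer_group_def mult_free_group weight_mult)

lemma weight_pow: "weight \<chi> (w [^]\<^bsub>free_group A\<^esub> (k::nat)) = int k * weight \<chi> w"
proof (induction k)
  case (Suc k)
  then show ?case
    by (simp add: monoid.nat_pow_Suc[OF group.is_monoid[OF group_free_group]] mult_free_group
        weight_mult algebra_simps)
qed (simp add: one_free_group nat_pow_def)

lemma weight_int_pow:
  assumes "w \<in> carrier (free_group A)"
  shows "weight \<chi> (w [^]\<^bsub>free_group A\<^esub> (k::int)) = k * weight \<chi> w"
proof -
  interpret group_hom "free_group A" integer_group "weight \<chi>"
    by (simp add: group_hom_def group_hom_axioms_def weight_hom group_free_group)
  show ?thesis using hom_int_pow[OF assms] by simp
qed

definition exponent_sum :: "'a letter list \<Rightarrow> 'a \<Rightarrow> int" where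
  "exponent_sum w i = weight (\<lambda>k. of_bool (k = i)) w"

lemma exponent_sum_Nil: "exponent_sum [] = (\<lambda>i. 0)"
  by (simp add: exponent_sum_def[abs_def])

lemma exponent_sum_Cons:
  "exponent_sum ((i, b) # w) = (\<lambda>k. (if k = i then (if b then 1 else -1) else 0) + exponent_sum w k)"
  by (auto simp: exponent_sum_def)

lemma weight_eq_sum_exponent_sum:
  assumes "finite A" "fst ` set w \<subseteq> A"
  shows "weight \<chi> w = (\<Sum>i\<in>A. \<chi> i * exponent_sum w i)"
  using assms(2)
proof (induction w)
  case Nil
  then show ?case by (simp add: exponent_sum_Nil)
next
  case (Cons l w)
  obtain i b where l: "l = (i, b)" by (cases l)
  have "i \<in> A" using Cons.prems l by simp
  have "(\<Sum>k\<in>A. \<chi> k * exponent_sum (l # w) k)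
      = (\<Sum>k\<in>A. if k = i then (if b then \<chi> k else - \<chi> k) else 0) + (\<Sum>k\<in>A. \<chi> k * exponent_sum w k)"
    unfolding sum.distrib[symmetric] by (rule sum.cong) (auto simp: l exponent_sum_Cons algebra_simps)
  then show ?case
    using Cons l \<open>i \<in> A\<close> assms(1) by (simp add: sum.delta)
qed


section \<open>Linear equations over an integral domain\<close>

text \<open>Elimination without division: an equation with a nonzero coefficient at \<open>p\<close> removes one equation
  and the unknown \<open>p\<close>, which is restored after scaling the other unknowns by that coefficient.\<close>
lemma homogeneous_system_nontrivial_solution:
  fixes a :: "'j \<Rightarrow> 'i \<Rightarrow> 'r::idom"
  assumes "finite J" "finite I" "card J < card I"
  shows "\<exists>x. (\<exists>i\<in>I. x i \<noteq> 0) \<and> (\<forall>j\<in>J. (\<Sum>i\<in>I. a j i * x i) = 0)"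
  using assms
proof (induction J arbitrary: I a rule: finite_induct)
  case empty
  then obtain i where "i \<in> I" by (metis card.empty card_gt_0_iff ex_in_conv)
  then show ?case by (intro exI[of _ "\<lambda>_. 1"]) auto
next
  case (insert j J)
  show ?case
  proof (cases "\<exists>p\<in>I. a j p \<noteq> 0")
    case False
    obtain x where x: "\<exists>i\<in>I. x i \<noteq> 0" "\<forall>k\<in>J. (\<Sum>i\<in>I. a k i * x i) = 0"
      using insert.IH[of I a] insert.prems insert.hyps by auto
    moreover have "(\<Sum>i\<in>I. a j i * x i) = 0" using False by (intro sum.neutral) auto
    ultimately show ?thesis by auto
  next
    case True
    then obtain p where p: "p \<in> I" "a j p \<noteq> 0" by blast
    define I' where "I' = I - {p}"
    have I': "finite I'" "p \<notin> I'" "I = insert p I'" and card: "card J < card I'"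
      using insert.prems insert.hyps p by (auto simp: I'_def card_Diff_singleton)
    obtain y where y: "\<exists>i\<in>I'. y i \<noteq> 0"
      "\<forall>k\<in>J. (\<Sum>i\<in>I'. (a j p * a k i - a k p * a j i) * y i) = 0"
      using insert.IH[OF I'(1) card, of "\<lambda>k i. a j p * a k i - a k p * a j i"] by auto
    define x where "x i = (if i = p then - (\<Sum>i\<in>I'. a j i * y i) else a j p * y i)" for i
    have sum_x: "(\<Sum>i\<in>I. a k i * x i) = (\<Sum>i\<in>I'. (a j p * a k i - a k p * a j i) * y i)" for k
    proof -
      have "(\<Sum>i\<in>I'. a k i * x i) = (\<Sum>i\<in>I'. a k i * (a j p * y i))"
        using I'(2) by (intro sum.cong) (auto simp: x_def)
      moreover have "a k p * x p = - (\<Sum>i\<in>I'. a k p * (a j i * y i))"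
        by (simp add: x_def sum_distrib_left)
      ultimately show ?thesis
        using I' by (simp add: algebra_simps sum_subtractf)
    qed
    have "\<forall>k\<in>insert j J. (\<Sum>i\<in>I. a k i * x i) = 0"
      using y(2) unfolding sum_x by (auto simp: mult.commute)
    moreover have "\<exists>i\<in>I. x i \<noteq> 0"
      using y(1) p I' by (auto simp: x_def)
    ultimately show ?thesis by blast
  qed
qed

text \<open>The Fredholm alternative without denominators: either a multiple of \<open>v\<close> is a combination of
  the vectors \<open>r j\<close>, or a functional vanishes on all of them but not on \<open>v\<close>.  The induction
  eliminates one coordinate with a vector \<open>r j\<close> that does not vanish there.\<close>
lemma fredholm_alternative_idom:
  fixes r :: "'j \<Rightarrow> 'i \<Rightarrow> 'r::idom" and v :: "'i \<Rightarrow> 'r"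
  assumes "finite J" "finite I"
  shows "(\<exists>d c. d \<noteq> 0 \<and> (\<forall>i\<in>I. d * v i = (\<Sum>j\<in>J. c j * r j i))) \<or>
    (\<exists>x. (\<forall>j\<in>J. (\<Sum>i\<in>I. x i * r j i) = 0) \<and> (\<Sum>i\<in>I. x i * v i) \<noteq> 0)"
  using assms(1)
proof (induction J arbitrary: r v rule: finite_induct)
  case empty
  show ?case
  proof (cases "\<forall>i\<in>I. v i = 0")
    case True
    then show ?thesis by (intro disjI1 exI[of _ 1]) auto
  next
    case False
    then obtain p where "p \<in> I" "v p \<noteq> 0" by blast
    then have "(\<Sum>i\<in>I. (if i = p then 1 else 0) * v i) \<noteq> 0"
      using sum.remove[OF assms(2), of p "\<lambda>i. (if i = p then 1 else 0) * v i"] by simp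
    then show ?thesis by (intro disjI2) auto
  qed
next
  case (insert j J)
  show ?case
  proof (cases "\<exists>p\<in>I. r j p \<noteq> 0")
    case False
    consider d c where "d \<noteq> 0" "\<forall>i\<in>I. d * v i = (\<Sum>k\<in>J. c k * r k i)" |
      x where "\<forall>k\<in>J. (\<Sum>i\<in>I. x i * r k i) = 0" "(\<Sum>i\<in>I. x i * v i) \<noteq> 0"
      using insert.IH[of v r] by blast
    then show ?thesis
    proof cases
      case 1
      then show ?thesis using False insert.hyps by (intro disjI1 exI[of _ d] exI[of _ c]) auto
    next
      case 2
      then show ?thesis using False insert.hyps by (intro disjI2 exI[of _ x]) auto
    qed
  next
    case True
    then obtain p where p: "p \<in> I" "r j p \<noteq> 0" by blast
    define d where "d = r j p"
    define elim where "elim u i = d * u i - u p * r j i" for u i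
    have elim_p: "elim u p = 0" for u by (simp add: elim_def d_def)
    consider e c where "e \<noteq> 0" "\<forall>i\<in>I. e * elim v i = (\<Sum>k\<in>J. c k * elim (r k) i)" |
      x where "\<forall>k\<in>J. (\<Sum>i\<in>I. x i * elim (r k) i) = 0" "(\<Sum>i\<in>I. x i * elim v i) \<noteq> 0"
      using insert.IH[of "elim v" "\<lambda>k. elim (r k)"] by blast
    then show ?thesis
    proof cases
      case 1
      define c' where "c' k = (if k = j then e * v p - (\<Sum>k\<in>J. c k * r k p) else d * c k)" for k
      have "(e * d) * v i = (\<Sum>k\<in>insert j J. c' k * r k i)" if "i \<in> I" for i
      proof -
        have "(\<Sum>k\<in>J. c' k * r k i) = (\<Sum>k\<in>J. d * c k * r k i)"
          using insert.hyps by (intro sum.cong) (auto simp: c'_def)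
        moreover have "(\<Sum>k\<in>J. c k * elim (r k) i)
            = (\<Sum>k\<in>J. d * c k * r k i) - (\<Sum>k\<in>J. c k * r k p) * r j i"
          by (simp add: elim_def right_diff_distrib sum_subtractf sum_distrib_right sum_distrib_left mult_ac)
        moreover have "e * elim v i = (\<Sum>k\<in>J. c k * elim (r k) i)" using 1 that by blast
        ultimately show ?thesis
          using insert.hyps by (simp add: c'_def elim_def algebra_simps)
      qed
      moreover have "e * d \<noteq> 0" using 1(1) p by (simp add: d_def)
      ultimately show ?thesis by blast
    next
      case 2
      define x' where "x' i = (if i = p then - (\<Sum>i\<in>I - {p}. x i * r j i) else d * x i)" for i
      have split: "(\<Sum>i\<in>I. f i) = f p + (\<Sum>i\<in>I - {p}. f i)" for f :: "'i \<Rightarrow> 'r"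
        using assms(2) p(1) by (rule sum.remove)
      have x'_elim: "(\<Sum>i\<in>I. x' i * elim u i) = d * (\<Sum>i\<in>I. x i * elim u i)" for u
        unfolding split elim_p by (auto simp: x'_def sum_distrib_left mult_ac intro!: sum.cong)
      have x'_j: "(\<Sum>i\<in>I. x' i * r j i) = 0"
      proof -
        have "(\<Sum>i\<in>I - {p}. x' i * r j i) = d * (\<Sum>i\<in>I - {p}. x i * r j i)"
          by (auto simp: x'_def sum_distrib_left mult_ac intro!: sum.cong)
        then show ?thesis by (simp add: split x'_def d_def)
      qed
      have x'_u: "d * (\<Sum>i\<in>I. x' i * u i) = d * (\<Sum>i\<in>I. x i * elim u i)" for u
      proof -
        have "(\<Sum>i\<in>I. x' i * elim u i) = d * (\<Sum>i\<in>I. x' i * u i) - u p * (\<Sum>i\<in>I. x' i * r j i)"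
          by (simp add: elim_def right_diff_distrib sum_subtractf sum_distrib_left mult_ac)
        then show ?thesis using x'_j x'_elim[of u] by (simp only: mult_zero_right diff_0_right)
      qed
      have "d \<noteq> 0" using p by (simp add: d_def)
      then have x'_u: "(\<Sum>i\<in>I. x' i * u i) = (\<Sum>i\<in>I. x i * elim u i)" for u
        using x'_u[of u] by simp
      have "\<forall>k\<in>insert j J. (\<Sum>i\<in>I. x' i * r k i) = 0"
        using 2(1) x'_j x'_u by auto
      moreover have "(\<Sum>i\<in>I. x' i * v i) \<noteq> 0" using 2(2) x'_u by simp
      ultimately show ?thesis by blast
    qed
  qed
qed


section \<open>Homomorphisms onto the integers\<close>

definition (in comm_group) exponent_prod :: "'i set \<Rightarrow> ('i \<Rightarrow> 'a) \<Rightarrow> ('i \<Rightarrow> int) \<Rightarrow> 'a" where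
  "exponent_prod A a e = (\<Otimes>i\<in>A. a i [^] e i)"

context comm_group
begin

context
  fixes A :: "'i set" and a :: "'i \<Rightarrow> 'a"
  assumes a: "\<And>i. i \<in> A \<Longrightarrow> a i \<in> carrier G"
begin

lemma exponent_prod_closed [simp]: "exponent_prod A a e \<in> carrier G"
  unfolding exponent_prod_def using a by (intro finprod_closed) auto

lemma exponent_prod_cong:
  "(\<And>i. i \<in> A \<Longrightarrow> a i [^] e i = a i [^] f i) \<Longrightarrow> exponent_prod A a e = exponent_prod A a f"
  unfolding exponent_prod_def using a by (intro finprod_cong') auto

lemma exponent_prod_0: "exponent_prod A a (\<lambda>i. 0) = \<one>"
  by (simp add: exponent_prod_def)

lemma exponent_prod_add:
  "exponent_prod A a (\<lambda>i. e i + f i) = exponent_prod A a e \<otimes> exponent_prod A a f"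
proof -
  have "exponent_prod A a (\<lambda>i. e i + f i) = (\<Otimes>i\<in>A. a i [^] e i \<otimes> a i [^] f i)"
    unfolding exponent_prod_def using a by (intro finprod_cong') (auto simp: int_pow_mult)
  then show ?thesis
    unfolding exponent_prod_def using a by (simp add: finprod_multf Pi_def)
qed

lemma exponent_prod_single:
  assumes "finite A" "i \<in> A"
  shows "exponent_prod A a (\<lambda>k. if k = i then d else 0) = a i [^] d"
proof -
  have "exponent_prod A a (\<lambda>k. if k = i then d else 0)
      = (\<Otimes>k\<in>A. if i = k then a k [^] d else \<one>)"
    unfolding exponent_prod_def using a by (intro finprod_cong') auto
  then show ?thesis using assms a by (simp add: finprod_singleton)
qed

lemma exponent_prod_mult:
  "exponent_prod A a (\<lambda>i. d * e i) = exponent_prod A a e [^] (d :: int)"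
proof (cases "finite A")
  case True
  then have "B \<subseteq> A \<Longrightarrow> (\<Otimes>i\<in>B. a i [^] (d * e i)) = (\<Otimes>i\<in>B. a i [^] e i) [^] d"
    for B
  proof (induction B rule: infinite_finite_induct)
    case (insert i B)
    then show ?case
      using a by (simp add: Pi_def subset_eq int_pow_distrib int_pow_pow mult.commute)
  qed (auto intro: finite_subset)
  then show ?thesis by (simp add: exponent_prod_def)
qed (simp add: exponent_prod_def)

end

lemma hom_eq_exponent_prod:
  assumes h: "h \<in> hom (free_group A) G" and fin: "finite A" and w: "w \<in> carrier (free_group A)"
  shows "h w = exponent_prod A (\<lambda>i. h [(i, True)]) (exponent_sum w)"
  using w
proof (induction w)
  case Nil
  then show ?case
    using hom_one[OF h group_free_group is_group]
    by (simp add: exponent_prod_def exponent_sum_Nil one_free_group)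
next
  case (Cons l w)
  interpret h: group_hom "free_group A" G h
    using h by (simp add: group_hom_def group_hom_axioms_def group_free_group)
  define a where "a k = h [(k, True)]" for k
  obtain i b where l: "l = (i, b)" by (cases l)
  have i: "i \<in> A" using Cons_free_group(3)[OF Cons.prems] l by simp
  have a: "a k \<in> carrier G" if "k \<in> A" for k
    using that by (simp add: a_def letter_in_free_group)
  have "h [l] = a i [^] (if b then 1 else -1 :: int)"
    using h.hom_inv[of "[(i, True)]"] i a[OF i] l
    by (simp add: inv_letter_free_group letter_in_free_group int_pow_neg a_def)
  also have "\<dots> = exponent_prod A a (\<lambda>k. if k = i then (if b then 1 else -1) else 0)"
    using exponent_prod_single[of A a, OF a fin i] by simp
  finally have "h [l] = exponent_prod A a (\<lambda>k. if k = i then (if b then 1 else -1) else 0)" .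
  moreover have "h (l # w) = h [l] \<otimes> h w"
    using Cons_free_group[OF Cons.prems] h.hom_mult[of "[l]" w] letter_in_free_group[of l A] by simp
  moreover have "h w = exponent_prod A a (exponent_sum w)"
    using Cons.IH Cons_free_group(1)[OF Cons.prems] by (simp add: a_def[abs_def])
  ultimately have "h (l # w) = exponent_prod A a (exponent_sum (l # w))"
    unfolding l exponent_sum_Cons by (simp only: exponent_prod_add[of A a, OF a])
  then show ?case by (simp add: a_def[abs_def])
qed

text \<open>Exponents may be reduced modulo the orders of the generators, which leaves finitely many
  products.\<close>
lemma finite_if_generators_torsion:
  assumes h: "h \<in> hom (free_group A) G" "h ` carrier (free_group A) = carrier G"
    and fin: "finite A"
    and tors: "\<And>i. i \<in> A \<Longrightarrow> \<exists>d::int. d \<noteq> 0 \<and> h [(i, True)] [^] d = \<one>"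
  shows "finite (carrier G)"
proof -
  define a where "a i = h [(i, True)]" for i
  have a: "a i \<in> carrier G" if "i \<in> A" for i
    using h(1) that by (auto simp: a_def hom_def letter_in_free_group)
  obtain d :: "_ \<Rightarrow> int" where d: "\<And>i. i \<in> A \<Longrightarrow> d i \<noteq> 0" "\<And>i. i \<in> A \<Longrightarrow> a i [^] d i = \<one>"
    using tors unfolding a_def by metis
  have "carrier G \<subseteq> exponent_prod A a ` (\<Pi>\<^sub>E i\<in>A. {-\<bar>d i\<bar>..\<bar>d i\<bar>})"
  proof
    fix g assume "g \<in> carrier G"
    then obtain w where w: "w \<in> carrier (free_group A)" "g = h w" using h(2) by blast
    define e where "e = exponent_sum w"
    define f where "f = restrict (\<lambda>i. e i mod d i) A"
    have "a i [^] e i = a i [^] f i" if "i \<in> A" for i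
    proof -
      have "a i [^] (d i * (e i div d i)) = \<one>"
        using d(2)[OF that] a[OF that] by (metis int_pow_pow int_pow_one)
      moreover have "a i [^] e i = a i [^] (d i * (e i div d i)) \<otimes> a i [^] (e i mod d i)"
        using a[OF that] by (metis int_pow_mult mult_div_mod_eq)
      ultimately show ?thesis using a[OF that] that by (simp add: f_def)
    qed
    then have "g = exponent_prod A a f"
      using hom_eq_exponent_prod[OF h(1) fin w(1)] exponent_prod_cong[of A a, OF a, of e f] w(2)
      by (simp add: e_def a_def[abs_def])
    moreover have "e i mod d i \<in> {-\<bar>d i\<bar>..\<bar>d i\<bar>}" if "i \<in> A" for i
      using abs_mod_less[OF d(1)[OF that], of "e i"] by (simp add: abs_less_iff less_imp_le)
    then have "f \<in> (\<Pi>\<^sub>E i\<in>A. {-\<bar>d i\<bar>..\<bar>d i\<bar>})" by (simp add: f_def)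
    ultimately show "g \<in> exponent_prod A a ` (\<Pi>\<^sub>E i\<in>A. {-\<bar>d i\<bar>..\<bar>d i\<bar>})" by blast
  qed
  then show ?thesis
    by (rule finite_subset) (intro finite_imageI finite_PiE fin finite_atLeastAtMost_int)
qed

text \<open>Some generator has infinite order.  Hence no nonzero multiple of its basis vector is a
  combination of the exponent vectors of the relators, and the Fredholm alternative yields a weight
  that vanishes on the relators but not on this generator.\<close>
lemma infinite_quotient_imp_weight:
  assumes h: "h \<in> hom (free_group A) G" "h ` carrier (free_group A) = carrier G"
    and inf: "infinite (carrier G)"
    and fin: "finite A" "finite R"
    and R: "R \<subseteq> carrier (free_group A)" "\<And>r. r \<in> R \<Longrightarrow> h r = \<one>"
  shows "\<exists>\<chi>. (\<exists>i\<in>A. \<chi> i \<noteq> 0) \<and> (\<forall>r\<in>R. weight \<chi> r = 0)"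
proof -
  define a where "a i = h [(i, True)]" for i
  have a: "a i \<in> carrier G" if "i \<in> A" for i
    using h(1) that by (auto simp: a_def hom_def letter_in_free_group)
  have h_eq: "h w = exponent_prod A a (exponent_sum w)" if "w \<in> carrier (free_group A)" for w
    using hom_eq_exponent_prod[OF h(1) fin(1) that] by (simp add: a_def[abs_def])
  obtain i where i: "i \<in> A" "\<And>d::int. d \<noteq> 0 \<Longrightarrow> a i [^] d \<noteq> \<one>"
    using finite_if_generators_torsion[OF h fin(1)] inf unfolding a_def by blast
  have no_torsion: False
    if d: "d \<noteq> 0" and c: "\<forall>k\<in>A. d * of_bool (k = i) = (\<Sum>r\<in>R. c r * exponent_sum r k)" for d :: int and c
  proof -
    have "a i [^] d = exponent_prod A a (\<lambda>k. if k = i then d else 0)"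
      by (rule exponent_prod_single[of A a, symmetric, OF a fin(1) i(1)])
    also have "\<dots> = exponent_prod A a (\<lambda>k. \<Sum>r\<in>R. c r * exponent_sum r k)"
      using c by (intro exponent_prod_cong[of A a, OF a]) (auto simp: of_bool_def split: if_splits)
    also have "\<dots> = \<one>"
      using fin(2) R
    proof (induction R rule: finite_induct)
      case empty
      then show ?case by (simp add: exponent_prod_0[of A a, OF a])
    next
      case (insert r R)
      have "exponent_prod A a (exponent_sum r) = \<one>"
        using h_eq[of r] insert.prems(1) insert.prems(2)[of r] by simp
      then have "exponent_prod A a (\<lambda>k. c r * exponent_sum r k) = \<one>"
        by (simp add: exponent_prod_mult[of A a, OF a])
      then show ?case
        using insert exponent_prod_add[of A a, OF a, of "\<lambda>k. c r * exponent_sum r k"] by simp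
    qed
    finally show False using i(2)[OF d] by simp
  qed
  have "\<exists>\<chi>. (\<forall>r\<in>R. (\<Sum>k\<in>A. \<chi> k * exponent_sum r k) = 0) \<and> (\<Sum>k\<in>A. \<chi> k * of_bool (k = i)) \<noteq> 0"
    using fredholm_alternative_idom[OF fin(2,1), of "\<lambda>k. of_bool (k = i)" exponent_sum]
  proof
    assume "\<exists>d c. d \<noteq> 0 \<and> (\<forall>k\<in>A. d * of_bool (k = i) = (\<Sum>r\<in>R. c r * exponent_sum r k))"
    then show ?thesis using no_torsion by (elim exE conjE) (rule FalseE)
  qed
  then obtain \<chi> where "(\<forall>r\<in>R. (\<Sum>k\<in>A. \<chi> k * exponent_sum r k) = 0) \<and> (\<Sum>k\<in>A. \<chi> k * of_bool (k = i)) \<noteq> 0" ..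
  then have \<chi>: "\<forall>r\<in>R. (\<Sum>k\<in>A. \<chi> k * exponent_sum r k) = 0"
    "(\<Sum>k\<in>A. \<chi> k * of_bool (k = i)) \<noteq> 0"
    by simp_all
  have "weight \<chi> r = 0" if "r \<in> R" for r
  proof -
    have "fst ` set r \<subseteq> A" using subsetD[OF R(1) that] by (simp add: carrier_free_group)
    from weight_eq_sum_exponent_sum[OF fin(1) this, of \<chi>] bspec[OF \<chi>(1) that]
    show ?thesis by (rule trans)
  qed
  moreover have "\<exists>k\<in>A. \<chi> k \<noteq> 0"
  proof (rule ccontr)
    assume "\<not> (\<exists>k\<in>A. \<chi> k \<noteq> 0)"
    then have "(\<Sum>k\<in>A. \<chi> k * of_bool (k = i)) = 0" by (intro sum.neutral) auto
    with \<chi>(2) show False by blast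
  qed
  ultimately show ?thesis by blast
qed

end

text \<open>The values of a nonzero weight form a subgroup of the integers.  Its least positive element \<open>g\<close>
  divides all of them, so dividing by \<open>g\<close> gives a weight that is onto.\<close>
lemma exists_primitive_weight:
  assumes i: "i \<in> A" "\<chi> i \<noteq> 0"
  shows "\<exists>\<psi> s g. s \<in> carrier (free_group A) \<and> weight \<psi> s = 1 \<and> g \<noteq> 0 \<and>
    (\<forall>w\<in>carrier (free_group A). weight \<chi> w = g * weight \<psi> w)"
proof -
  interpret F: group "free_group A" by (rule group_free_group)
  let ?P = "\<lambda>k::nat. k > 0 \<and> (\<exists>w\<in>carrier (free_group A). weight \<chi> w = int k)"
  have "?P (nat \<bar>\<chi> i\<bar>)"
    using i by (auto intro!: bexI[of _ "[(i, \<chi> i > 0)]"] letter_in_free_group)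
  then obtain g where g: "?P g" and min: "\<And>k. k < g \<Longrightarrow> \<not> ?P k"
    using exists_least_iff[of ?P] by blast
  then obtain s where s: "s \<in> carrier (free_group A)" "weight \<chi> s = int g" by blast
  have dvd: "int g dvd weight \<chi> w" if w: "w \<in> carrier (free_group A)" for w
  proof (rule ccontr)
    assume not_dvd: "\<not> int g dvd weight \<chi> w"
    define v where
      "v = w \<otimes>\<^bsub>free_group A\<^esub> s [^]\<^bsub>free_group A\<^esub> (- (weight \<chi> w div int g))"
    have "v \<in> carrier (free_group A)"
      unfolding v_def using w s(1) by (intro F.m_closed F.int_pow_closed)
    moreover have "weight \<chi> v = weight \<chi> w mod int g"
      unfolding v_def mult_free_group weight_mult weight_int_pow[OF s(1)] s(2)
      by (simp add: minus_div_mult_eq_mod)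
    moreover have "weight \<chi> w mod int g \<noteq> 0"
      using not_dvd by (simp add: mod_eq_0_iff_dvd)
    then have "0 < weight \<chi> w mod int g"
      using g pos_mod_sign[of "int g" "weight \<chi> w"] by linarith
    ultimately have "?P (nat (weight \<chi> w mod int g))" by auto
    moreover have "nat (weight \<chi> w mod int g) < g" using g by (simp add: nat_less_iff)
    ultimately show False using min by blast
  qed
  define \<psi> where "\<psi> k = \<chi> k div int g" for k
  have scale: "weight \<chi> w = int g * weight \<psi> w" if "w \<in> carrier (free_group A)" for w
  proof -
    have "fst ` set w \<subseteq> A" using that by (simp add: carrier_free_group)
    then show ?thesis
    proof (induction w)
      case (Cons l w)
      obtain k b where l: "l = (k, b)" by (cases l)
      have "int g dvd \<chi> k"
        using dvd[of "[(k, True)]"] Cons.prems l by (simp add: letter_in_free_group)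
      then show ?case using Cons l by (simp add: \<psi>_def algebra_simps)
    qed simp
  qed
  have "weight \<psi> s = 1" using scale[OF s(1)] s(2) g by simp
  then show ?thesis using s(1) scale g by (intro exI[of _ \<psi>] exI[of _ s] exI[of _ "int g"]) auto
qed


section \<open>Largeness from labelled actions\<close>

text \<open>An action of the free group on \<open>V\<close> whose edges carry labels in a group \<open>B\<close>.  Equivalently, an
  action on \<open>V \<times> B\<close> that commutes with the right multiplications of \<open>B\<close>.  Words act from right to
  left.\<close>
locale labelled_action = B: group B for B :: "('b, 'c) monoid_scheme" (structure) +
  fixes V :: "'x set" and step :: "'a letter \<Rightarrow> 'x \<Rightarrow> 'x" and label :: "'a letter \<Rightarrow> 'x \<Rightarrow> 'b"
  assumes step_closed [simp]: "x \<in> V \<Longrightarrow> step a x \<in> V"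
    and label_closed [simp]: "x \<in> V \<Longrightarrow> label a x \<in> carrier B"
    and step_flip [simp]: "x \<in> V \<Longrightarrow> step (flip a) (step a x) = x"
    and label_flip: "x \<in> V \<Longrightarrow> label (flip a) (step a x) = inv label a x"
begin

abbreviation move :: "'a letter list \<Rightarrow> 'x \<Rightarrow> 'x" where
  "move w x \<equiv> foldr step w x"

primrec path_label :: "'a letter list \<Rightarrow> 'x \<Rightarrow> 'b" where
  "path_label [] x = \<one>"
| "path_label (a # w) x = label a (move w x) \<otimes> path_label w x"

lemma move_closed [simp]: "x \<in> V \<Longrightarrow> move w x \<in> V"
  by (induction w) auto

lemma path_label_closed [simp]: "x \<in> V \<Longrightarrow> path_label w x \<in> carrier B"
  by (induction w) auto

lemma step_flip' [simp]: "x \<in> V \<Longrightarrow> step a (step (flip a) x) = x"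
  using step_flip[of x "flip a"] by simp

lemma move_cancel_Cons: "x \<in> V \<Longrightarrow> move (cancel_Cons a w) x = step a (move w x)"
  by (cases w) auto

lemma path_label_cancel_Cons:
  assumes x: "x \<in> V"
  shows "path_label (cancel_Cons a w) x = label a (move w x) \<otimes> path_label w x"
proof (cases "\<exists>v. w = flip a # v")
  case True
  then obtain v where w: "w = flip a # v" by blast
  have "label a (move w x) = inv label (flip a) (move v x)"
    using label_flip[of "move v x" "flip a"] x by (simp add: w)
  then show ?thesis using x by (simp add: w flip: B.m_assoc)
next
  case False
  then show ?thesis by (cases w) auto
qed

lemma move_mult: "x \<in> V \<Longrightarrow> move (foldr cancel_Cons v w) x = move v (move w x)"
  by (induction v) (auto simp: move_cancel_Cons)

lemma path_label_mult:
  "x \<in> V \<Longrightarrow> path_label (foldr cancel_Cons v w) x = path_label v (move w x) \<otimes> path_label w x"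
  by (induction v) (auto simp: path_label_cancel_Cons move_mult B.m_assoc)

lemma move_inv:
  assumes "w \<in> carrier (free_group A)" "x \<in> V"
  shows "move (inv\<^bsub>free_group A\<^esub> w) (move w x) = x" "move w (move (inv\<^bsub>free_group A\<^esub> w) x) = x"
  using group.l_inv[OF group_free_group assms(1)] group.r_inv[OF group_free_group assms(1)] assms(2)
  by (auto simp: mult_free_group one_free_group simp flip: move_mult)

lemma path_label_inv:
  assumes "w \<in> carrier (free_group A)" "x \<in> V"
  shows "path_label (inv\<^bsub>free_group A\<^esub> w) (move w x) = inv path_label w x"
proof -
  have "path_label (inv\<^bsub>free_group A\<^esub> w) (move w x) \<otimes> path_label w x = \<one>"
    using group.l_inv[OF group_free_group assms(1)] assms(2)
    by (simp add: mult_free_group one_free_group flip: path_label_mult)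
  then show ?thesis using assms(2) by (simp add: B.inv_equality[symmetric])
qed

definition acts_trivially :: "'a letter list \<Rightarrow> bool" where
  "acts_trivially w \<longleftrightarrow> (\<forall>x\<in>V. move w x = x \<and> path_label w x = \<one>)"

lemma normal_closure_acts_trivially:
  assumes R: "R \<subseteq> carrier (free_group A)" "\<And>r. r \<in> R \<Longrightarrow> acts_trivially r"
    and w: "w \<in> normal_closure (free_group A) R"
  shows "acts_trivially w"
  using w unfolding normal_closure_def
proof (induction rule: generate.induct)
  case one
  then show ?case by (simp add: acts_trivially_def one_free_group)
next
  interpret F: group "free_group A" by (rule group_free_group)
  have conj: "acts_trivially h \<and> h \<in> carrier (free_group A)"
    if "h \<in> (\<Union>g\<in>carrier (free_group A). \<Union>r\<in>R.
      {g \<otimes>\<^bsub>free_group A\<^esub> r \<otimes>\<^bsub>free_group A\<^esub> inv\<^bsub>free_group A\<^esub> g})" for h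
  proof -
    from that obtain g r where g: "g \<in> carrier (free_group A)" and r: "r \<in> R"
      and h: "h = g \<otimes>\<^bsub>free_group A\<^esub> r \<otimes>\<^bsub>free_group A\<^esub> inv\<^bsub>free_group A\<^esub> g" by blast
    have "move h x = x \<and> path_label h x = \<one>" if x: "x \<in> V" for x
    proof -
      define y where "y = move (inv\<^bsub>free_group A\<^esub> g) x"
      have y: "y \<in> V" "move g y = x" using x move_inv(2)[OF g x] by (simp_all add: y_def)
      then have "path_label (inv\<^bsub>free_group A\<^esub> g) x = inv path_label g y"
        using path_label_inv[OF g y(1)] by simp
      then show ?thesis
        using x y R(2)[OF r]
        by (simp add: h mult_free_group move_mult path_label_mult acts_trivially_def
            flip: y_def)
    qed
    moreover have "h \<in> carrier (free_group A)" using g r R(1) by (auto simp: h)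
    ultimately show ?thesis by (simp add: acts_trivially_def)
  qed
  {
    case (incl h)
    then show ?case using conj by blast
  next
    case (inv h)
    then have h: "acts_trivially h" "h \<in> carrier (free_group A)" using conj by blast+
    have "move (inv\<^bsub>free_group A\<^esub> h) x = x \<and> path_label (inv\<^bsub>free_group A\<^esub> h) x = \<one>"
      if "x \<in> V" for x
      using move_inv(1)[OF h(2) that] path_label_inv[OF h(2) that] h(1) that
      by (simp add: acts_trivially_def)
    then show ?case by (simp add: acts_trivially_def)
  next
    case (eng h1 h2)
    then show ?case by (simp add: acts_trivially_def mult_free_group move_mult path_label_mult)
  }
qed

definition stabiliser :: "'a set \<Rightarrow> 'x \<Rightarrow> 'a letter list set" where
  "stabiliser A x = {w \<in> carrier (free_group A). move w x = x}"

lemma subgroup_stabiliser: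
  assumes "x \<in> V"
  shows "subgroup (stabiliser A x) (free_group A)"
proof -
  interpret F: group "free_group A" by (rule group_free_group)
  show ?thesis
  proof (rule F.subgroupI)
    show "stabiliser A x \<noteq> {}"
      using F.one_closed by (auto simp: stabiliser_def one_free_group)
  next
    fix w assume "w \<in> stabiliser A x"
    then show "inv\<^bsub>free_group A\<^esub> w \<in> stabiliser A x"
      using move_inv(1)[of w A x] assms by (auto simp: stabiliser_def)
  next
    fix v w assume "v \<in> stabiliser A x" "w \<in> stabiliser A x"
    then show "v \<otimes>\<^bsub>free_group A\<^esub> w \<in> stabiliser A x"
      using assms F.m_closed[of v w] by (auto simp: stabiliser_def mult_free_group move_mult)
  qed (auto simp: stabiliser_def)
qed

text \<open>The coset of \<open>w\<close> is determined by the point to which the inverse of \<open>w\<close> moves \<open>x\<close>.\<close>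
lemma finite_rcosets_stabiliser:
  assumes "finite V" "x \<in> V"
  shows "finite (rcosets\<^bsub>free_group A\<^esub> (stabiliser A x))"
proof -
  interpret F: group "free_group A" by (rule group_free_group)
  let ?S = "stabiliser A x"
  have S: "subgroup ?S (free_group A)" by (rule subgroup_stabiliser[OF assms(2)])
  define f where "f w = move (inv\<^bsub>free_group A\<^esub> w) x" for w
  define c where "c y = ?S #>\<^bsub>free_group A\<^esub> (SOME w. w \<in> carrier (free_group A) \<and> f w = y)" for y
  have "?S #>\<^bsub>free_group A\<^esub> w = c (f w)" if w: "w \<in> carrier (free_group A)" for w
  proof -
    define v where "v = (SOME v. v \<in> carrier (free_group A) \<and> f v = f w)"
    have v: "v \<in> carrier (free_group A)" "f v = f w"
      using someI[of "\<lambda>v. v \<in> carrier (free_group A) \<and> f v = f w" w] w by (auto simp: v_def)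
    have "move (w \<otimes>\<^bsub>free_group A\<^esub> inv\<^bsub>free_group A\<^esub> v) x = x"
      using v(2) move_inv(2)[OF w assms(2)] assms(2) by (simp add: f_def mult_free_group move_mult)
    then have "w \<otimes>\<^bsub>free_group A\<^esub> inv\<^bsub>free_group A\<^esub> v \<in> ?S"
      using v(1) w by (simp add: stabiliser_def)
    then have "?S #>\<^bsub>free_group A\<^esub> w = ?S #>\<^bsub>free_group A\<^esub> v"
      using F.coset_mult_inv1[of ?S w v] F.coset_join2[of _ ?S] S v(1) w subgroup.subset[OF S]
      by simp
    then show ?thesis by (simp add: c_def v_def)
  qed
  then have "rcosets\<^bsub>free_group A\<^esub> ?S \<subseteq> c ` V"
    using assms(2) by (auto simp: RCOSETS_def f_def)
  then show ?thesis using assms(1) by (auto intro: finite_subset)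
qed

end

text \<open>The labels along closed paths at \<open>x\<close> form a homomorphism on the stabiliser of \<open>x\<close>, which has
  finite index.  Every element of the normal closure of the relators fixes all points with trivial
  labels, so the stabiliser and the homomorphism descend to the presented group.\<close>
lemma labelled_action_imp_virtually_onto_free:
  assumes act: "labelled_action (free_group C) V step label"
    and fin: "finite A" "finite V" and x: "x \<in> V"
    and R: "R \<subseteq> carrier (free_group A)"
      "\<And>r. r \<in> R \<Longrightarrow> labelled_action.acts_trivially (free_group C) V step label r"
    and onto: "\<And>i. i \<in> C \<Longrightarrow> \<exists>w\<in>labelled_action.stabiliser step A x.
      labelled_action.path_label (free_group C) step label w x = [(i, True)]"
  shows "finitely_generated_group (presented_group A R)"
    and "\<exists>H. subgroup H (presented_group A R) \<and> finite (rcosets\<^bsub>presented_group A R\<^esub> H) \<and>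
      epi (presented_group A R\<lparr>carrier := H\<rparr>) (free_group C) \<noteq> {}"
proof -
  interpret labelled_action "free_group C" V step label by (rule act)
  interpret F: group "free_group A" by (rule group_free_group)
  define N where "N = normal_closure (free_group A) R"
  define Q where "Q = presented_group A R"
  define \<pi> where "\<pi> w = N #>\<^bsub>free_group A\<^esub> w" for w
  define S where "S = stabiliser A x"
  interpret N: normal N "free_group A"
    unfolding N_def by (rule F.normal_closure_normal[OF R(1)])
  have Q: "Q = free_group A Mod N" by (simp add: Q_def presented_group_def N_def)
  interpret Q: group Q unfolding Q by (rule N.factorgroup_is_group)
  have \<pi>_hom: "\<pi> \<in> hom (free_group A) Q"
    using N.r_coset_hom_Mod by (simp add: \<pi>_def[abs_def] Q)
  interpret \<pi>: group_hom "free_group A" Q \<pi>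
    using \<pi>_hom by (simp add: group_hom_def group_hom_axioms_def F.is_group Q.is_group)
  have \<pi>_onto: "carrier Q = \<pi> ` carrier (free_group A)"
    by (simp add: Q carrier_FactGroup \<pi>_def[abs_def])
  have S: "subgroup S (free_group A)" unfolding S_def by (rule subgroup_stabiliser[OF x])
  have trivial: "acts_trivially w" if "w \<in> N" for w
    using normal_closure_acts_trivially[OF R] that by (simp add: N_def)

  show "finitely_generated_group (presented_group A R)"
  proof -
    let ?gens = "(\<lambda>i. \<pi> [(i, True)]) ` A"
    have sub: "?gens \<subseteq> carrier Q" by (auto simp: letter_in_free_group)
    have "subgroup (generate Q ?gens) Q" by (rule Q.generate_is_subgroup[OF sub])
    then have "\<pi> w \<in> generate Q ?gens" if "w \<in> carrier (free_group A)" for w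
      by (rule free_group_subset[OF _ \<pi>_hom _ Q.is_group that]) (auto intro: generate.incl)
    then have "generate Q ?gens = carrier Q"
      using Q.generate_incl[OF sub] \<pi>_onto by auto
    then show ?thesis
      using sub fin(1) Q.is_group unfolding finitely_generated_group_def Q_def by blast
  qed
  have H: "subgroup (\<pi> ` S) Q" by (rule \<pi>.subgroup_img_is_subgroup[OF S])
  moreover have "finite (rcosets\<^bsub>Q\<^esub> (\<pi> ` S))"
  proof -
    have "\<pi> ` S #>\<^bsub>Q\<^esub> \<pi> w = \<pi> ` (S #>\<^bsub>free_group A\<^esub> w)" if "w \<in> carrier (free_group A)" for w
      using that subgroup.mem_carrier[OF S] by (auto simp: r_coset_def image_UN)
    then have "rcosets\<^bsub>Q\<^esub> (\<pi> ` S) \<subseteq> (`) \<pi> ` (rcosets\<^bsub>free_group A\<^esub> S)"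
      by (auto simp: RCOSETS_def \<pi>_onto)
    then show ?thesis
      using finite_rcosets_stabiliser[OF fin(2) x, of A] by (auto simp: S_def intro: finite_subset)
  qed
  moreover have "epi (Q\<lparr>carrier := \<pi> ` S\<rparr>) (free_group C) \<noteq> {}"
  proof -
    have eq: "path_label v x = path_label w x" if "v \<in> S" "w \<in> S" "\<pi> v = \<pi> w" for v w
    proof -
      have "v \<in> N #>\<^bsub>free_group A\<^esub> w"
        using that F.rcos_self[of v N] subgroup.mem_carrier[OF S] N.subgroup_axioms
        by (metis \<pi>_def)
      then obtain h where "h \<in> N" "v = h \<otimes>\<^bsub>free_group A\<^esub> w" by (auto simp: r_coset_def)
      then show ?thesis
        using trivial[of h] x that(2)
        by (simp add: mult_free_group[where A = A] path_label_mult acts_trivially_def)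
    qed
    define \<theta> where "\<theta> K = path_label (SOME w. w \<in> S \<and> \<pi> w = K) x" for K
    have \<theta>: "\<theta> (\<pi> w) = path_label w x" if "w \<in> S" for w
    proof -
      define v where "v = (SOME v. v \<in> S \<and> \<pi> v = \<pi> w)"
      have "v \<in> S \<and> \<pi> v = \<pi> w"
        unfolding v_def by (rule someI[of _ w]) (simp add: that)
      then have "path_label v x = path_label w x" using eq that by blast
      then show ?thesis by (simp only: \<theta>_def v_def)
    qed
    have "\<theta> \<in> hom (Q\<lparr>carrier := \<pi> ` S\<rparr>) (free_group C)"
    proof (rule homI)
      fix K assume "K \<in> carrier (Q\<lparr>carrier := \<pi> ` S\<rparr>)"
      then show "\<theta> K \<in> carrier (free_group C)" using x \<theta> by auto
    next
      fix K L assume "K \<in> carrier (Q\<lparr>carrier := \<pi> ` S\<rparr>)" "L \<in> carrier (Q\<lparr>carrier := \<pi> ` S\<rparr>)"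
      then obtain v w where vw: "v \<in> S" "w \<in> S" "K = \<pi> v" "L = \<pi> w" by auto
      have "\<pi> v \<otimes>\<^bsub>Q\<^esub> \<pi> w = \<pi> (v \<otimes>\<^bsub>free_group A\<^esub> w)"
        using vw subgroup.mem_carrier[OF S] by (simp add: \<pi>.hom_mult)
      moreover have "v \<otimes>\<^bsub>free_group A\<^esub> w \<in> S" using vw subgroup.m_closed[OF S] by blast
      moreover have "path_label (v \<otimes>\<^bsub>free_group A\<^esub> w) x
          = path_label v x \<otimes>\<^bsub>free_group C\<^esub> path_label w x"
        using vw x by (simp add: mult_free_group[where A = A] path_label_mult S_def stabiliser_def)
      ultimately show "\<theta> (K \<otimes>\<^bsub>Q\<lparr>carrier := \<pi> ` S\<rparr>\<^esub> L) = \<theta> K \<otimes>\<^bsub>free_group C\<^esub> \<theta> L"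
        using vw \<theta> by simp
    qed
    moreover from this have "\<theta> ` (\<pi> ` S) = carrier (free_group C)"
    proof -
      assume hom: "\<theta> \<in> hom (Q\<lparr>carrier := \<pi> ` S\<rparr>) (free_group C)"
      interpret \<theta>: group_hom "Q\<lparr>carrier := \<pi> ` S\<rparr>" "free_group C" \<theta>
        using hom Q.subgroup_imp_group[OF H]
        by (simp add: group_hom_def group_hom_axioms_def group_free_group)
      show ?thesis
      proof (rule subgroup_free_group_eq)
        show "subgroup (\<theta> ` \<pi> ` S) (free_group C)"
          using \<theta>.img_is_subgroup by simp
        show "[(i, True)] \<in> \<theta> ` \<pi> ` S" if "i \<in> C" for i
          using onto[OF that] \<theta> by (force simp: S_def)
      qed
    qed
    ultimately show ?thesis by (auto simp: epi_def)
  qed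
  ultimately show "\<exists>H. subgroup H (presented_group A R) \<and> finite (rcosets\<^bsub>presented_group A R\<^esub> H) \<and>
      epi (presented_group A R\<lparr>carrier := H\<rparr>) (free_group C) \<noteq> {}"
    using H unfolding Q_def by blast
qed


section \<open>Lamp functions\<close>

text \<open>A word \<open>w\<close> describes a walk on the integers that reads \<open>w\<close> from right to left and moves by
  \<open>\<chi> i\<close> at the letter \<open>x\<^sub>i\<close>.  The sum collects \<open>\<phi> i k\<close> whenever the walk from \<open>j\<close> leaves \<open>k\<close> along
  \<open>x\<^sub>i\<close>, and \<open>- \<phi> i k\<close> whenever it returns to \<open>k\<close> along this edge.  Up to a power of \<open>z\<close>, its
  generating function in \<open>j\<close>, with variable \<open>z\<close>, is the derivation that maps \<open>x\<^sub>i\<close> to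
  \<open>z\<close> to the power \<open>\<chi> i\<close> times the generating function of \<open>\<phi> i\<close>, applied to \<open>w\<close>; here the
  free group acts on Laurent polynomials in \<open>z\<close> through \<open>\<chi>\<close>.\<close>
primrec lamp_sum :: "('a \<Rightarrow> int) \<Rightarrow> ('a \<Rightarrow> int \<Rightarrow> int) \<Rightarrow> 'a letter list \<Rightarrow> int \<Rightarrow> int" where
  "lamp_sum \<chi> \<phi> [] j = 0"
| "lamp_sum \<chi> \<phi> (a # w) j = lamp_sum \<chi> \<phi> w j +
    (if snd a then \<phi> (fst a) (j + weight \<chi> w) else - \<phi> (fst a) (j + weight \<chi> w - \<chi> (fst a)))"

definition reach :: "('a \<Rightarrow> int) \<Rightarrow> 'a letter list \<Rightarrow> int" where
  "reach \<chi> w = (\<Sum>(i, b)\<leftarrow>w. \<bar>\<chi> i\<bar>)"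

lemma reach_simps [simp]: "reach \<chi> [] = 0" "reach \<chi> (a # w) = \<bar>\<chi> (fst a)\<bar> + reach \<chi> w"
  by (simp_all add: reach_def case_prod_beta)

lemma reach_nonneg: "0 \<le> reach \<chi> w"
  by (induction w) auto

lemma abs_weight_le_reach: "\<bar>weight \<chi> w\<bar> \<le> reach \<chi> w"
  by (induction w) (auto split: if_splits)

lemma lamp_sum_eq_0:
  assumes "\<And>i k. \<bar>k - j\<bar> \<le> reach \<chi> w \<Longrightarrow> \<phi> i k = 0"
  shows "lamp_sum \<chi> \<phi> w j = 0"
  using assms
proof (induction w)
  case (Cons a w)
  have "\<bar>weight \<chi> w\<bar> \<le> reach \<chi> w" by (rule abs_weight_le_reach)
  then have "\<phi> (fst a) (j + weight \<chi> w) = 0" "\<phi> (fst a) (j + weight \<chi> w - \<chi> (fst a)) = 0"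
    by (auto intro!: Cons.prems)
  moreover have "lamp_sum \<chi> \<phi> w j = 0"
    by (rule Cons.IH) (auto intro!: Cons.prems)
  ultimately show ?case by simp
qed simp

lemma lamp_sum_sum:
  "lamp_sum \<chi> (\<lambda>i k. \<Sum>p\<in>S. x p * f p i k) w j = (\<Sum>p\<in>S. x p * lamp_sum \<chi> (f p) w j)"
  by (induction w) (auto simp: sum.distrib distrib_left sum_negf)

lemma lamp_sum_mult_left: "lamp_sum \<chi> (\<lambda>i k. c * \<phi> i k) w j = c * lamp_sum \<chi> \<phi> w j"
  by (induction w) (auto simp: distrib_left)

text \<open>Division by \<open>q\<close> decreases the absolute value of a nonzero entry, so it can be repeated only
  finitely often.\<close>
lemma divide_out_common_factor:
  fixes \<phi> :: "'a \<Rightarrow> int \<Rightarrow> int"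
  assumes "q > 1" "\<phi> i k \<noteq> 0"
  shows "\<exists>c \<psi>. c \<noteq> 0 \<and> (\<forall>i k. \<phi> i k = c * \<psi> i k) \<and> (\<exists>i k. \<not> q dvd \<psi> i k)"
  using assms(2)
proof (induction "nat \<bar>\<phi> i k\<bar>" arbitrary: \<phi> rule: less_induct)
  case less
  show ?case
  proof (cases "\<forall>i k. q dvd \<phi> i k")
    case True
    define \<psi> where "\<psi> i k = \<phi> i k div q" for i k
    have \<phi>: "\<phi> i k = q * \<psi> i k" for i k using True by (simp add: \<psi>_def)
    then have nz: "\<psi> i k \<noteq> 0" using less.prems by auto
    have "\<bar>\<phi> i k\<bar> = q * \<bar>\<psi> i k\<bar>" using assms(1) by (simp add: \<phi> abs_mult)
    moreover have "1 * \<bar>\<psi> i k\<bar> < q * \<bar>\<psi> i k\<bar>"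
      using assms(1) nz by (intro mult_strict_right_mono) auto
    ultimately have "nat \<bar>\<psi> i k\<bar> < nat \<bar>\<phi> i k\<bar>" by linarith
    then obtain c \<theta> where "c \<noteq> 0" "\<forall>i k. \<psi> i k = c * \<theta> i k" "\<exists>i k. \<not> q dvd \<theta> i k"
      using less.hyps nz by blast
    then show ?thesis
      using assms(1) by (intro exI[of _ "q * c"] exI[of _ \<theta>]) (auto simp: \<phi> fun_eq_iff mult.assoc)
  next
    case False
    then show ?thesis by (intro exI[of _ 1] exI[of _ \<phi>]) auto
  qed
qed

text \<open>For \<open>\<phi>\<close> supported in a window of length \<open>L\<close>, there are \<open>card A * L\<close> unknowns, but each word
  of reach at most \<open>M\<close> only gives the \<open>L + 2 * M\<close> equations at starting points near the window.
  With fewer words than letters, a long window leaves more unknowns than equations.\<close>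
lemma exists_lamp_function:
  fixes \<chi> :: "'a \<Rightarrow> int" and q P M :: int
  assumes fin: "finite A" "finite W" and card: "card W < card A"
    and reach: "\<And>w. w \<in> W \<Longrightarrow> reach \<chi> w \<le> M" and M: "0 \<le> M" and q: "q > 1"
  shows "\<exists>L \<phi>. (\<forall>i k. \<phi> i k \<noteq> 0 \<longrightarrow> i \<in> A \<and> P \<le> k \<and> k < P + L) \<and>
    (\<exists>i k. \<not> q dvd \<phi> i k) \<and> (\<forall>w\<in>W. \<forall>j. lamp_sum \<chi> \<phi> w j = 0)"
proof -
  define L where "L = int (card W) * (2 * M) + 1"
  define S where "S = A \<times> {P..<P + L}"
  define J where "J = W \<times> {P - M..<P + L + M}"
  have L: "0 \<le> L" using M by (simp add: L_def)
  have "int (card J) < int (card S)"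
  proof -
    have "int (card J) = int (card W) * L + int (card W) * (2 * M)"
      using L M by (simp add: J_def card_cartesian_product algebra_simps)
    also have "\<dots> < int (card W) * L + L" by (simp add: L_def)
    also have "\<dots> = (int (card W) + 1) * L" by (simp add: algebra_simps)
    also have "\<dots> \<le> int (card A) * L" using card L by (intro mult_right_mono) auto
    also have "\<dots> = int (card S)" using L by (simp add: S_def card_cartesian_product)
    finally show ?thesis .
  qed
  then have less: "card J < card S" by simp
  have finS: "finite S" and finJ: "finite J" using fin by (simp_all add: S_def J_def)
  define f where "f p i k = (of_bool ((i, k) = p) :: int)" for p :: "'a \<times> int" and i k
  obtain x where x: "\<exists>p\<in>S. x p \<noteq> 0"
    "\<forall>y\<in>J. (\<Sum>p\<in>S. lamp_sum \<chi> (f p) (fst y) (snd y) * x p) = 0"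
    using homogeneous_system_nontrivial_solution[OF finJ finS less,
        of "\<lambda>y p. lamp_sum \<chi> (f p) (fst y) (snd y)"] by blast
  define \<phi> where "\<phi> i k = (\<Sum>p\<in>S. x p * f p i k)" for i k
  have \<phi>: "\<phi> i k = (if (i, k) \<in> S then x (i, k) else 0)" for i k
  proof -
    have "\<phi> i k = (\<Sum>p\<in>S. if (i, k) = p then x p else 0)"
      unfolding \<phi>_def f_def by (intro sum.cong) auto
    then show ?thesis using finS by (simp only: sum.delta')
  qed
  have zero: "lamp_sum \<chi> \<phi> w j = 0" if w: "w \<in> W" for w j
  proof (cases "j \<in> {P - M..<P + L + M}")
    case True
    then have "(w, j) \<in> J" using w by (simp add: J_def)
    then have "(\<Sum>p\<in>S. x p * lamp_sum \<chi> (f p) w j) = 0"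
      using x(2) by (auto simp: mult.commute)
    then show ?thesis unfolding \<phi>_def[abs_def] lamp_sum_sum .
  next
    case False
    show ?thesis
    proof (rule lamp_sum_eq_0)
      fix i k assume "\<bar>k - j\<bar> \<le> reach \<chi> w"
      then have "k \<notin> {P..<P + L}" using False reach[OF w] by auto
      then have "(i, k) \<notin> S" by (auto simp: S_def)
      then show "\<phi> i k = 0" by (simp only: \<phi> if_False)
    qed
  qed
  obtain i k where "(i, k) \<in> S" "x (i, k) \<noteq> 0" using x(1) by auto
  then have "\<phi> i k \<noteq> 0" by (simp add: \<phi>)
  from divide_out_common_factor[where \<phi> = \<phi>, OF q this]
  obtain c \<psi> where c: "c \<noteq> 0" "\<forall>i k. \<phi> i k = c * \<psi> i k" "\<exists>i k. \<not> q dvd \<psi> i k"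
    by blast
  then have \<psi>: "c \<noteq> 0" "\<phi> = (\<lambda>i k. c * \<psi> i k)" "\<exists>i k. \<not> q dvd \<psi> i k"
    by (auto simp: fun_eq_iff)
  have "i \<in> A \<and> P \<le> k \<and> k < P + L" if "\<psi> i k \<noteq> 0" for i k
  proof -
    have "\<phi> i k \<noteq> 0" using that \<psi>(1) by (simp add: \<psi>(2))
    then show ?thesis by (auto simp: \<phi> S_def split: if_splits)
  qed
  moreover have "lamp_sum \<chi> \<psi> w j = 0" if "w \<in> W" for w j
    using zero[OF that, of j] \<psi>(1) by (simp add: \<psi>(2) lamp_sum_mult_left)
  ultimately show ?thesis using \<psi>(3) by (intro exI[of _ L] exI[of _ \<psi>]) blast
qed


section \<open>Lamps on a cycle\<close>

text \<open>A vertex consists of the position of the walker modulo \<open>N\<close> and the lamp total modulo \<open>q\<close>.  The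
  label of an edge is a power of \<open>T c\<close>, where \<open>c\<close> is the lamp total at the source of the edge in
  positive direction, and the exponent counts the signed crossings of the seam between \<open>N - 1\<close>
  and \<open>0\<close>.  The lamps keep the distance \<open>2 * M\<close> from the seam, so that walks of reach at most \<open>M\<close>
  cannot meet both.\<close>
locale lamp_cycle = B: group B for B :: "('b, 'c) monoid_scheme" (structure) +
  fixes \<chi> :: "'a \<Rightarrow> int" and \<phi> :: "'a \<Rightarrow> int \<Rightarrow> int" and N q M :: int and T :: "int \<Rightarrow> 'b"
  assumes N: "0 < N" and q: "1 < q"
    and T [simp]: "T c \<in> carrier B"
    and support: "\<phi> i k \<noteq> 0 \<Longrightarrow> 2 * M \<le> k \<and> k < N - 2 * M"
begin

definition vertices :: "(int \<times> int) set" where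
  "vertices = {0..<N} \<times> {0..<q}"

definition cycle_step :: "'a letter \<Rightarrow> int \<times> int \<Rightarrow> int \<times> int" where
  "cycle_step = (\<lambda>(i, b) (j, c).
    if b then ((j + \<chi> i) mod N, (c + \<phi> i j) mod q)
    else ((j - \<chi> i) mod N, (c - \<phi> i ((j - \<chi> i) mod N)) mod q))"

definition cycle_label :: "'a letter \<Rightarrow> int \<times> int \<Rightarrow> 'b" where
  "cycle_label = (\<lambda>(i, b) (j, c).
    if b then T c [^] ((j + \<chi> i) div N)
    else T ((c - \<phi> i ((j - \<chi> i) mod N)) mod q) [^] ((j - \<chi> i) div N))"

lemma cycle_step_simps [simp]:
  "cycle_step (i, True) (j, c) = ((j + \<chi> i) mod N, (c + \<phi> i j) mod q)"
  "cycle_step (i, False) (j, c) = ((j - \<chi> i) mod N, (c - \<phi> i ((j - \<chi> i) mod N)) mod q)"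
  by (simp_all add: cycle_step_def)

lemma cycle_label_simps [simp]:
  "cycle_label (i, True) (j, c) = T c [^] ((j + \<chi> i) div N)"
  "cycle_label (i, False) (j, c) =
    T ((c - \<phi> i ((j - \<chi> i) mod N)) mod q) [^] ((j - \<chi> i) div N)"
  by (simp_all add: cycle_label_def)

text \<open>An edge crosses the seam as often backwards as forwards, with the opposite sign.\<close>
lemma div_shift_back: "0 \<le> j \<Longrightarrow> j < N \<Longrightarrow> ((j + e) mod N - e) div N = - ((j + e) div N)"
proof -
  assume j: "0 \<le> j" "j < N"
  have "(j + e) mod N - e = j + N * (- ((j + e) div N))"
    using minus_mult_div_eq_mod[of "j + e" N] by (simp add: algebra_simps)
  then show ?thesis using N j by (simp only: div_mult_self2) simp
qed

sublocale labelled_action B vertices cycle_step cycle_label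
proof
  fix x :: "int \<times> int" and a :: "'a letter" assume x: "x \<in> vertices"
  obtain j c where jc: "x = (j, c)" "0 \<le> j" "j < N" "0 \<le> c" "c < q"
    using x by (auto simp: vertices_def)
  obtain i b where a: "a = (i, b)" by (cases a)
  show "cycle_step a x \<in> vertices"
    using N q by (cases b) (auto simp: vertices_def a jc(1))
  show "cycle_label a x \<in> carrier B"
    by (cases b) (auto simp: a jc(1))
  show "cycle_step (flip a) (cycle_step a x) = x"
    using jc by (cases b) (auto simp: a mod_simps)
  show "cycle_label (flip a) (cycle_step a x) = inv cycle_label a x"
    using div_shift_back[OF jc(2,3), of "\<chi> i"] div_shift_back[OF jc(2,3), of "- \<chi> i"] jc
    by (cases b) (auto simp: a mod_simps B.int_pow_neg)
qed

lemma lamp_mod: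
  assumes "- M \<le> k" "k < N + M" "0 \<le> M" "2 * M \<le> N"
  shows "\<phi> i (k mod N) = \<phi> i k"
proof -
  consider "0 \<le> k" "k < N" | "k < 0" | "N \<le> k" by linarith
  then show ?thesis
  proof cases
    case 1
    then show ?thesis by simp
  next
    case 2
    have "k mod N = (k + N) mod N" by simp
    also have "\<dots> = k + N" using 2 assms N by (intro mod_pos_pos_trivial) auto
    finally show ?thesis using 2 assms support[of i k] support[of i "k + N"] by fastforce
  next
    case 3
    have "k mod N = (k - N) mod N" by simp
    also have "\<dots> = k - N" using 3 assms N by (intro mod_pos_pos_trivial) auto
    finally show ?thesis using 3 assms support[of i k] support[of i "k - N"] by fastforce
  qed
qed

lemma lamp_sum_nonzero_window:
  assumes "lamp_sum \<chi> \<phi> w j \<noteq> 0" "reach \<chi> w \<le> M" "\<bar>l - j\<bar> \<le> M"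
  shows "0 \<le> l \<and> l < N"
proof -
  obtain i k where "\<bar>k - j\<bar> \<le> reach \<chi> w" "\<phi> i k \<noteq> 0"
    using assms(1) lamp_sum_eq_0 by metis
  then show ?thesis using support[of i k] assms(2,3) by linarith
qed

lemma div_add_mod: "(k mod N + e) div N + k div N = (k + e) div N"
proof -
  have "k + e = (k mod N + e) + N * (k div N)" by simp
  then show ?thesis using N by (metis add.commute div_mult_self2 less_irrefl)
qed

text \<open>On short walks the cycle looks like the integers.  If the lamp total ever changes, the whole walk
  stays in \<open>{0..<N}\<close> and all labels are trivial; otherwise all labels are powers of the same element
  \<open>T c\<close>, and the exponents add up.\<close>
lemma short_word:
  assumes jc: "(j, c) \<in> vertices" and w: "reach \<chi> w \<le> M"
  shows "move w (j, c) = ((j + weight \<chi> w) mod N, (c + lamp_sum \<chi> \<phi> w j) mod q)"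
    and "path_label w (j, c) = T c [^] ((j + weight \<chi> w) div N)"
proof -
  have j: "0 \<le> j" "j < N" and c: "0 \<le> c" "c < q" using jc by (auto simp: vertices_def)
  have label_add: "T ((c + D) mod q) [^] ((k mod N + e) div N) \<otimes> T c [^] (k div N)
      = T c [^] ((k + e) div N)"
    if window: "D \<noteq> 0 \<Longrightarrow> (0 \<le> k \<and> k < N) \<and> (0 \<le> k + e \<and> k + e < N)" for D k e
  proof (cases "D = 0")
    case True
    then show ?thesis using c by (simp add: B.int_pow_mult flip: div_add_mod[of k e])
  next
    case False
    then show ?thesis using window by simp
  qed
  have "0 \<le> M" using w reach_nonneg[of \<chi> w] by linarith
  show "move w (j, c) = ((j + weight \<chi> w) mod N, (c + lamp_sum \<chi> \<phi> w j) mod q)"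
    and "path_label w (j, c) = T c [^] ((j + weight \<chi> w) div N)"
    using w
  proof (induction w)
    case Nil
    { case 1 show ?case using j c by simp }
    { case 2 show ?case using j by simp }
  next
    case (Cons a w)
    {
      obtain i b where a: "a = (i, b)" by (cases a)
      assume aw: "reach \<chi> (a # w) \<le> M"
      define k where "k = j + weight \<chi> w"
      define e where "e = (if b then \<chi> i else - \<chi> i)"
      define D where "D = lamp_sum \<chi> \<phi> w j"
      define D' where "D' = lamp_sum \<chi> \<phi> (a # w) j"
      have w: "reach \<chi> w \<le> M" using aw by simp
      have k: "\<bar>k - j\<bar> \<le> M" "\<bar>k + e - j\<bar> \<le> M"
        using aw abs_weight_le_reach[of \<chi> w] by (auto simp: k_def e_def a)
      have IH: "move w (j, c) = (k mod N, (c + D) mod q)" "path_label w (j, c) = T c [^] (k div N)"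
        using Cons.IH w by (auto simp: k_def D_def)
      have weight: "j + weight \<chi> (a # w) = k + e" by (simp add: k_def e_def a)
      have D': "D' = (if b then D + \<phi> i k else D - \<phi> i (k + e))"
        by (simp add: D'_def D_def a k_def e_def)
      have small: "\<phi> i (l mod N) = \<phi> i l" if "\<bar>l - j\<bar> \<le> M" for l
      proof (cases "2 * M \<le> N")
        case True
        then show ?thesis using that j \<open>0 \<le> M\<close> by (intro lamp_mod) auto
      next
        case False
        then have "\<phi> i l = 0" for l using support[of i l] \<open>0 \<le> M\<close> by (cases "\<phi> i l = 0") auto
        then show ?thesis by simp
      qed
      have "move (a # w) (j, c) = ((k + e) mod N, (c + D') mod q)"
        using small[OF k(1)] small[OF k(2)]
        by (cases b) (simp_all add: IH(1) a e_def D' mod_simps algebra_simps)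
      moreover have "path_label (a # w) (j, c) = T c [^] ((k + e) div N)"
      proof (cases b)
        case True
        have "path_label (a # w) (j, c) = T ((c + D) mod q) [^] ((k mod N + e) div N) \<otimes> T c [^] (k div N)"
          using True by (simp add: IH a e_def)
        also have "\<dots> = T c [^] ((k + e) div N)"
          using lamp_sum_nonzero_window[of w j] w k by (intro label_add) (simp add: D_def)
        finally show ?thesis .
      next
        case False
        have "path_label (a # w) (j, c) = T ((c + D') mod q) [^] ((k mod N + e) div N) \<otimes> T c [^] (k div N)"
          using False small[OF k(2)]
          by (simp add: IH a e_def D' mod_simps algebra_simps)
        also have "\<dots> = T c [^] ((k + e) div N)"
          using lamp_sum_nonzero_window[OF _ aw] k by (intro label_add) (simp add: D'_def)
        finally show ?thesis .
      qed
      ultimately have "move (a # w) (j, c) = ((j + weight \<chi> (a # w)) mod N, (c + lamp_sum \<chi> \<phi> (a # w) j) mod q)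
        \<and> path_label (a # w) (j, c) = T c [^] ((j + weight \<chi> (a # w)) div N)"
        unfolding weight D'_def by blast
    }
    note step = this
    { case 1 then show ?case using step by blast }
    { case 2 then show ?case using step by blast }
  qed
qed

text \<open>Each of the \<open>m\<close> readings of \<open>u\<close> starts from the same position, since \<open>u\<close> has weight \<open>0\<close>, and
  changes the lamp total by the same amount.\<close>
lemma power_acts_trivially:
  assumes u: "reach \<chi> u \<le> M" "weight \<chi> u = 0" and dvd: "\<And>j. q dvd int m * lamp_sum \<chi> \<phi> u j"
  shows "acts_trivially (u [^]\<^bsub>free_group A\<^esub> m)"
proof -
  have pow: "move (u [^]\<^bsub>free_group A\<^esub> k) (j, c) = (j, (c + int k * lamp_sum \<chi> \<phi> u j) mod q) \<and>
      path_label (u [^]\<^bsub>free_group A\<^esub> k) (j, c) = \<one>"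
    if "(j, c) \<in> vertices" for j c and k :: nat
    using that
  proof (induction k arbitrary: c)
    case 0
    then show ?case by (simp add: vertices_def one_free_group nat_pow_def)
  next
    case (Suc k)
    have j: "0 \<le> j" "j < N" using Suc.prems by (auto simp: vertices_def)
    define c' where "c' = (c + lamp_sum \<chi> \<phi> u j) mod q"
    have u': "move u (j, c) = (j, c')" "path_label u (j, c) = \<one>"
      using short_word[OF Suc.prems u(1)] u(2) j by (auto simp: c'_def)
    have "(j, c') \<in> vertices" using j q by (simp add: vertices_def c'_def)
    then show ?case
      using Suc.IH[of c'] u' Suc.prems
      by (simp add: monoid.nat_pow_Suc[OF group.is_monoid[OF group_free_group]] mult_free_group
          move_mult path_label_mult c'_def mod_simps algebra_simps)
  qed
  show ?thesis
    unfolding acts_trivially_def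
  proof
    fix x assume x: "x \<in> vertices"
    obtain j c where jc: "x = (j, c)" "0 \<le> c" "c < q" using x by (auto simp: vertices_def)
    obtain d where "int m * lamp_sum \<chi> \<phi> u j = q * d" using dvd by blast
    then show "move (u [^]\<^bsub>free_group A\<^esub> m) x = x \<and> path_label (u [^]\<^bsub>free_group A\<^esub> m) x = \<one>"
      using pow[of j c m] x jc by simp
  qed
qed

text \<open>Powers of \<open>t\<close> move the walker along the cycle without changing the lamp total.  A full turn
  from \<open>(0, c)\<close> therefore has label \<open>T c\<close>.\<close>
lemma turn:
  assumes t: "t \<in> carrier (free_group A)" "reach \<chi> t \<le> M" "weight \<chi> t = 1"
      "\<And>j. lamp_sum \<chi> \<phi> t j = 0"
    and c: "0 \<le> c" "c < q"
  shows "int k < N \<Longrightarrow> move (t [^]\<^bsub>free_group A\<^esub> k) (0, c) = (int k, c) \<and>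
      path_label (t [^]\<^bsub>free_group A\<^esub> k) (0, c) = \<one>"
    and "move (t [^]\<^bsub>free_group A\<^esub> nat N) (0, c) = (0, c) \<and>
      path_label (t [^]\<^bsub>free_group A\<^esub> nat N) (0, c) = T c"
proof -
  interpret F: group "free_group A" by (rule group_free_group)
  have pow_Suc: "t [^]\<^bsub>free_group A\<^esub> Suc k = foldr cancel_Cons t (t [^]\<^bsub>free_group A\<^esub> k)" for k
    using F.nat_pow_Suc2[OF t(1), of k] by (simp only: mult_free_group)
  have V: "(j, c) \<in> vertices" if "0 \<le> j" "j < N" for j
    using that c by (simp add: vertices_def)
  have one_step: "move t (j, c) = ((j + 1) mod N, c)" "path_label t (j, c) = T c [^] ((j + 1) div N)"
    if "0 \<le> j" "j < N" for j
    using short_word[OF V[OF that] t(2)] t(3,4) c by simp_all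
  have part: "int k < N \<Longrightarrow> move (t [^]\<^bsub>free_group A\<^esub> k) (0, c) = (int k, c) \<and>
      path_label (t [^]\<^bsub>free_group A\<^esub> k) (0, c) = \<one>" for k
  proof (induction k)
    case 0
    then show ?case by (simp add: one_free_group)
  next
    case (Suc k)
    then show ?case
      unfolding pow_Suc
      using one_step[of "int k"] V[of 0] N by (simp add: move_mult path_label_mult add.commute)
  qed
  show "int k < N \<Longrightarrow> move (t [^]\<^bsub>free_group A\<^esub> k) (0, c) = (int k, c) \<and>
      path_label (t [^]\<^bsub>free_group A\<^esub> k) (0, c) = \<one>"
    by (rule part)
  have Suc: "nat N = Suc (nat (N - 1))" using N by simp
  show "move (t [^]\<^bsub>free_group A\<^esub> nat N) (0, c) = (0, c) \<and>
      path_label (t [^]\<^bsub>free_group A\<^esub> nat N) (0, c) = T c"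
    unfolding Suc pow_Suc
    using part[of "nat (N - 1)"] one_step[of "N - 1"] V[of 0] N
    by (simp add: move_mult path_label_mult)
qed

text \<open>A full turn from \<open>(0, 0)\<close> has label \<open>T 0\<close>.  For the other label, \<open>e\<close> first moves from \<open>(0, 0)\<close> to
  \<open>(0, \<phi> i k mod q)\<close> with trivial label, and the turn is conjugated by \<open>e\<close>.\<close>
lemma label_loops:
  assumes t: "t \<in> carrier (free_group A)" "reach \<chi> t \<le> M" "weight \<chi> t = 1"
      "\<And>j. lamp_sum \<chi> \<phi> t j = 0"
    and i: "i \<in> A" "\<bar>\<chi> i\<bar> \<le> M" and lamp: "\<not> q dvd \<phi> i k"
  shows "\<exists>w\<in>stabiliser A (0, 0). path_label w (0, 0) = T 0"
    and "\<exists>w\<in>stabiliser A (0, 0). path_label w (0, 0) = T (\<phi> i k mod q)"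
proof -
  interpret F: group "free_group A" by (rule group_free_group)
  let ?pow = "\<lambda>k. t [^]\<^bsub>free_group A\<^esub> nat k"
  define c where "c = \<phi> i k mod q"
  have c: "0 \<le> c" "c < q" using q by (simp_all add: c_def)
  have V: "(0, 0) \<in> vertices" "(0, c) \<in> vertices" using N q c by (simp_all add: vertices_def)
  have pow_closed: "?pow l \<in> carrier (free_group A)" for l using t(1) by simp
  have turn_N: "move (?pow N) (0, d) = (0, d)" "path_label (?pow N) (0, d) = T d"
    if "0 \<le> d" "d < q" for d
    using turn(2)[OF t that] by auto
  have turn_part: "move (?pow l) (0, d) = (l, d)" "path_label (?pow l) (0, d) = \<one>"
    if "0 \<le> d" "d < q" "0 \<le> l" "l < N" for l d
    using turn(1)[OF t that(1,2), of "nat l"] that(3,4) by auto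
  show "\<exists>w\<in>stabiliser A (0, 0). path_label w (0, 0) = T 0"
    using turn_N[of 0] q pow_closed by (intro bexI[of _ "?pow N"]) (auto simp: stabiliser_def)

  have "\<phi> i k \<noteq> 0" using lamp by auto
  then have k: "0 \<le> k" "k < N" "0 \<le> k + \<chi> i" "k + \<chi> i < N"
    using support[of i k] i(2) by auto
  (* e walks to position k, where the letter x_i changes the lamp total, and walks back.  The powers
     of t on both sides keep the lamp total constant. *)
  define e where
    "e = inv\<^bsub>free_group A\<^esub> (?pow (k + \<chi> i)) \<otimes>\<^bsub>free_group A\<^esub> ([(i, True)] \<otimes>\<^bsub>free_group A\<^esub> ?pow k)"
  have e: "e \<in> carrier (free_group A)"
    unfolding e_def using pow_closed i(1) by (intro F.m_closed F.inv_closed letter_in_free_group) auto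
  have vc: "move (?pow (k + \<chi> i)) (0, c) = (k + \<chi> i, c)" "path_label (?pow (k + \<chi> i)) (0, c) = \<one>"
    using turn_part[OF c k(3,4)] by auto
  have return: "move (inv\<^bsub>free_group A\<^esub> (?pow (k + \<chi> i))) (k + \<chi> i, c) = (0, c)"
    "path_label (inv\<^bsub>free_group A\<^esub> (?pow (k + \<chi> i))) (k + \<chi> i, c) = \<one>"
    using move_inv(1)[OF pow_closed V(2), of "k + \<chi> i"]
      path_label_inv[OF pow_closed V(2), of "k + \<chi> i"] vc by auto
  have letter: "cycle_step (i, True) (k, 0) = (k + \<chi> i, c)" "cycle_label (i, True) (k, 0) = \<one>"
    using k by (auto simp: c_def)
  have move_e: "move e (0, 0) = (0, c)" and label_e: "path_label e (0, 0) = \<one>"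
    using turn_part[of 0 k] k q V(1) letter return
    by (auto simp: e_def mult_free_group move_mult path_label_mult move_cancel_Cons path_label_cancel_Cons)
  define w where
    "w = inv\<^bsub>free_group A\<^esub> e \<otimes>\<^bsub>free_group A\<^esub> (?pow N \<otimes>\<^bsub>free_group A\<^esub> e)"
  have "w \<in> carrier (free_group A)"
    unfolding w_def using pow_closed e by (intro F.m_closed F.inv_closed) auto
  moreover have "move w (0, 0) = (0, 0)" "path_label w (0, 0) = T c"
    using V turn_N[OF c] move_e label_e move_inv(1)[OF e V(1)] path_label_inv[OF e V(1)]
    by (auto simp: w_def mult_free_group move_mult path_label_mult)
  ultimately show "\<exists>w\<in>stabiliser A (0, 0). path_label w (0, 0) = T (\<phi> i k mod q)"
    unfolding c_def[symmetric] by (intro bexI[of _ w]) (auto simp: stabiliser_def)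
qed

end


section \<open>Groups whose relators are proper powers\<close>

lemma subset_normal_closure:
  assumes "group G" "R \<subseteq> carrier G"
  shows "R \<subseteq> normal_closure G R"
proof
  interpret group G by (rule assms(1))
  fix r assume r: "r \<in> R"
  then have "r = \<one>\<^bsub>G\<^esub> \<otimes>\<^bsub>G\<^esub> r \<otimes>\<^bsub>G\<^esub> inv\<^bsub>G\<^esub> \<one>\<^bsub>G\<^esub>" using assms(2) by auto
  then show "r \<in> normal_closure G R"
    unfolding normal_closure_def using r by (intro generate.incl) (metis (no_types, lifting) UN_I one_closed singletonI)
qed

lemma infinite_abelianisation_imp_weight:
  assumes fin: "finite A" "finite R" and R: "R \<subseteq> carrier (free_group A)"
    and inf: "infinite (carrier (abelianisation (presented_group A R)))"
  shows "\<exists>\<chi>. (\<exists>i\<in>A. \<chi> i \<noteq> 0) \<and> (\<forall>r\<in>R. weight \<chi> r = 0)"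
proof -
  define N where "N = normal_closure (free_group A) R"
  define P where "P = presented_group A R"
  define D where "D = derived P (carrier P)"
  interpret F: group "free_group A" by (rule group_free_group)
  interpret N: normal N "free_group A"
    unfolding N_def by (rule F.normal_closure_normal[OF R])
  have P: "P = free_group A Mod N" by (simp add: P_def presented_group_def N_def)
  interpret P: group P unfolding P by (rule N.factorgroup_is_group)
  interpret D: normal D P
    unfolding D_def by (rule P.derived_self_is_normal)
  interpret Q: comm_group "P Mod D"
    unfolding D_def by (rule P.derived_quot_is_comm_group)
  define h where "h w = D #>\<^bsub>P\<^esub> (N #>\<^bsub>free_group A\<^esub> w)" for w
  have "h \<in> hom (free_group A) (P Mod D)"
    using hom_compose[OF N.r_coset_hom_Mod] D.r_coset_hom_Mod
    by (simp add: h_def[abs_def] P comp_def)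
  moreover have "h ` carrier (free_group A) = carrier (P Mod D)"
    by (auto simp: h_def carrier_FactGroup P image_image)
  moreover have "h r = \<one>\<^bsub>P Mod D\<^esub>" if "r \<in> R" for r
  proof -
    have "r \<in> N" using subset_normal_closure[OF group_free_group R] that by (auto simp: N_def)
    then have "N #>\<^bsub>free_group A\<^esub> r = \<one>\<^bsub>P\<^esub>"
      using F.coset_join2[OF _ N.subgroup_axioms] N.mem_carrier by (simp add: P)
    then show ?thesis
      using P.coset_join2[OF P.one_closed D.subgroup_axioms D.one_closed] by (simp add: h_def)
  qed
  moreover have "infinite (carrier (P Mod D))"
    using inf by (simp add: abelianisation_def P_def D_def)
  ultimately show ?thesis
    using Q.infinite_quotient_imp_weight[of h A R] fin R by blast
qed

text \<open>A relator with \<open>q dvd m i\<close> changes the lamp total by a multiple of \<open>q\<close>, whatever the lamp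
  function is.  So the lamp function only has to vanish on the other \<open>u i\<close> and on one element of
  weight \<open>1\<close>.\<close>
theorem large_group_of_power_relators:
  fixes u :: "'i \<Rightarrow> 'a letter list" and m :: "'i \<Rightarrow> nat" and q :: nat
  assumes fin: "finite A" "finite I"
    and u: "\<And>i. i \<in> I \<Longrightarrow> u i \<in> carrier (free_group A)"
    and m: "\<And>i. i \<in> I \<Longrightarrow> m i \<ge> 1"
    and inf: "infinite (carrier (abelianisation
           (presented_group A ((\<lambda>i. u i [^]\<^bsub>free_group A\<^esub> m i) ` I))))"
    and q: "q > 1" and few: "card {i \<in> I. \<not> q dvd m i} + 1 < card A"
  shows "large_group (presented_group A ((\<lambda>i. u i [^]\<^bsub>free_group A\<^esub> m i) ` I))"
proof -
  note One_nat_def [simp del]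
  let ?F = "free_group A"
  define R where "R = (\<lambda>i. u i [^]\<^bsub>?F\<^esub> m i) ` I"
  interpret F: group ?F by (rule group_free_group)
  have R: "R \<subseteq> carrier ?F" using u F.nat_pow_closed by (auto simp: R_def)
  have finR: "finite R" using fin(2) by (simp add: R_def)
  obtain \<chi>\<^sub>0 i\<^sub>0 where \<chi>\<^sub>0: "i\<^sub>0 \<in> A" "\<chi>\<^sub>0 i\<^sub>0 \<noteq> 0" "\<And>r. r \<in> R \<Longrightarrow> weight \<chi>\<^sub>0 r = 0"
    using infinite_abelianisation_imp_weight[OF fin(1) finR R inf[folded R_def]] by blast
  obtain \<chi> t g where t: "t \<in> carrier ?F" "weight \<chi> t = 1" and g: "g \<noteq> 0"
    and scale: "\<And>w. w \<in> carrier ?F \<Longrightarrow> weight \<chi>\<^sub>0 w = g * weight \<chi> w"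
    using exists_primitive_weight[of i\<^sub>0 A \<chi>\<^sub>0, OF \<chi>\<^sub>0(1,2)] by blast
  have weight_u: "weight \<chi> (u e) = 0" if e: "e \<in> I" for e
  proof -
    have "weight \<chi>\<^sub>0 (u e [^]\<^bsub>?F\<^esub> m e) = 0" using \<chi>\<^sub>0(3) e by (simp add: R_def)
    then have "int (m e) * (g * weight \<chi> (u e)) = 0"
      using scale[OF u[OF e]] by (simp add: weight_pow)
    then show ?thesis using m[OF e] g by simp
  qed

  (* Asking that the lamp sums of t vanish as well makes the powers of t walk around the cycle at
     a constant lamp total. *)
  define W where "W = insert t (u ` {e \<in> I. \<not> q dvd m e})"
  have "card W < card A"
  proof -
    have "card W \<le> Suc (card (u ` {e \<in> I. \<not> q dvd m e}))"
      using fin by (simp add: W_def card_insert_if)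
    also have "card (u ` {e \<in> I. \<not> q dvd m e}) \<le> card {e \<in> I. \<not> q dvd m e}"
      using fin by (intro card_image_le) simp
    finally show ?thesis using few by simp
  qed

  define M where "M = reach \<chi> t + (\<Sum>e\<in>I. reach \<chi> (u e)) + (\<Sum>i\<in>A. \<bar>\<chi> i\<bar>)"
  have sums: "0 \<le> (\<Sum>e\<in>I. reach \<chi> (u e))" "0 \<le> (\<Sum>i\<in>A. \<bar>\<chi> i\<bar>)"
    by (auto intro: sum_nonneg reach_nonneg)
  have reach_t: "reach \<chi> t \<le> M" using sums by (simp add: M_def)
  have reach_u: "reach \<chi> (u e) \<le> M" if "e \<in> I" for e
  proof -
    have "reach \<chi> (u e) \<le> (\<Sum>e\<in>I. reach \<chi> (u e))"
      using that fin by (intro member_le_sum) (auto simp: reach_nonneg)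
    then show ?thesis using sums reach_nonneg[of \<chi> t] unfolding M_def by linarith
  qed
  have reach_letter: "\<bar>\<chi> i\<bar> \<le> M" if "i \<in> A" for i
  proof -
    have "\<bar>\<chi> i\<bar> \<le> (\<Sum>i\<in>A. \<bar>\<chi> i\<bar>)" using that fin by (intro member_le_sum) auto
    then show ?thesis using sums reach_nonneg[of \<chi> t] unfolding M_def by linarith
  qed
  have "0 \<le> M" using reach_t reach_nonneg[of \<chi> t] by linarith

  have "finite W" using fin(2) by (simp add: W_def)
  have reach_W: "reach \<chi> w \<le> M" if "w \<in> W" for w
    using that reach_t reach_u by (auto simp: W_def)
  have "\<exists>L \<phi>. (\<forall>i k. \<phi> i k \<noteq> 0 \<longrightarrow> i \<in> A \<and> 2 * M \<le> k \<and> k < 2 * M + L) \<and>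
      (\<exists>i k. \<not> int q dvd \<phi> i k) \<and> (\<forall>w\<in>W. \<forall>j. lamp_sum \<chi> \<phi> w j = 0)"
    by (rule exists_lamp_function[OF fin(1) \<open>finite W\<close> \<open>card W < card A\<close> _ \<open>0 \<le> M\<close>])
      (use reach_W q in auto)
  then obtain L \<phi> where
    lamps: "(\<forall>i k. \<phi> i k \<noteq> 0 \<longrightarrow> i \<in> A \<and> 2 * M \<le> k \<and> k < 2 * M + L) \<and>
      (\<exists>i k. \<not> int q dvd \<phi> i k) \<and> (\<forall>w\<in>W. \<forall>j. lamp_sum \<chi> \<phi> w j = 0)"
    by (elim exE) (rule that)
  have support: "i \<in> A \<and> 2 * M \<le> k \<and> k < 2 * M + L" if "\<phi> i k \<noteq> 0" for i k
    using conjunct1[OF lamps] that by simp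
  have nonzero: "\<exists>i k. \<not> int q dvd \<phi> i k" using conjunct2[OF lamps] by (rule conjunct1)
  have zero: "lamp_sum \<chi> \<phi> w j = 0" if "w \<in> W" for w j
    using conjunct2[OF lamps] that by simp
  obtain i k where ik: "\<not> int q dvd \<phi> i k" using nonzero by blast
  then have "\<phi> i k \<noteq> 0" by auto
  then have i: "i \<in> A" and "0 < L" using support[of i k] by auto

  (* The lamps occupy the window from 2 * M to 2 * M + L, which leaves a gap of 2 * M on both
     sides of the seam. *)
  define N where "N = 4 * M + L"
  define T :: "int \<Rightarrow> nat letter list" where "T c = [(if c = 0 then 1 else 2, True)]" for c
  interpret lamp_cycle "free_group {1, 2}" \<chi> \<phi> N "int q" M T
  proof (intro lamp_cycle.intro lamp_cycle_axioms.intro group_free_group)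
    show "2 * M \<le> k \<and> k < N - 2 * M" if "\<phi> i k \<noteq> 0" for i k
      using support[OF that] by (simp add: N_def)
  qed (use \<open>0 \<le> M\<close> \<open>0 < L\<close> q in \<open>auto simp: N_def T_def letter_in_free_group\<close>)

  have origin: "(0, 0) \<in> vertices" using N q by (simp add: vertices_def)
  have trivial: "acts_trivially r" if "r \<in> R" for r
  proof -
    obtain e where e: "e \<in> I" "r = u e [^]\<^bsub>?F\<^esub> m e" using \<open>r \<in> R\<close> by (auto simp: R_def)
    have "int q dvd int (m e) * lamp_sum \<chi> \<phi> (u e) j" for j
      using zero[of "u e" j] e(1) by (cases "q dvd m e") (auto simp: W_def)
    then show ?thesis
      unfolding e(2) by (intro power_acts_trivially reach_u weight_u e(1))
  qed
  have loops: "\<exists>w\<in>stabiliser A (0, 0). path_label w (0, 0) = [(l, True)]"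
    if "l \<in> {1, 2}" for l :: nat
  proof -
    have "\<And>j. lamp_sum \<chi> \<phi> t j = 0" using zero by (simp add: W_def)
    note loops = label_loops[OF t(1) reach_t t(2) this i reach_letter[OF i] ik]
    have "T 0 = [(1, True)]" "T (\<phi> i k mod int q) = [(2, True)]"
      using ik by (auto simp: T_def dvd_eq_mod_eq_0)
    then show ?thesis using loops that by auto
  qed
  have "finite vertices" by (simp add: vertices_def)
  then show ?thesis
    using labelled_action_imp_virtually_onto_free[OF labelled_action_axioms fin(1) _ origin R
        trivial loops]
    unfolding large_group_def R_def[symmetric] by blast
qed

theorem corollary3p6:
  fixes n s :: nat
    and u :: "nat \<Rightarrow> nat letter list"
    and m :: "nat \<Rightarrow> nat"
  assumes "n > 1"
    and "\<And>i. i \<in> {1..s} \<Longrightarrow> u i \<in> carrier (free_group {1..n})"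
    and "\<And>i. i \<in> {1..s} \<Longrightarrow> m i \<ge> 1"
    and "infinite (carrier (abelianisation
           (presented_group {1..n} ((\<lambda>i. u i [^]\<^bsub>free_group {1..n}\<^esub> m i) ` {1..s}))))"
    and "\<exists>q>1. int (card {i \<in> {1..s}. q dvd m i}) \<ge> int s - int n + 2"
  shows "large_group
           (presented_group {1..n} ((\<lambda>i. u i [^]\<^bsub>free_group {1..n}\<^esub> m i) ` {1..s}))"
proof -
  obtain q where q: "q > 1" "int (card {i \<in> {1..s}. q dvd m i}) \<ge> int s - int n + 2"
    using assms(5) by blast
  have "{1..s} = {i \<in> {1..s}. q dvd m i} \<union> {i \<in> {1..s}. \<not> q dvd m i}" by auto
  then have "card {1..s} = card {i \<in> {1..s}. q dvd m i} + card {i \<in> {1..s}. \<not> q dvd m i}"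
    by (metis (no_types, lifting) card_Un_disjoint disjoint_iff finite_Un finite_atLeastAtMost mem_Collect_eq)
  then have "int (card {i \<in> {1..s}. \<not> q dvd m i}) + 1 < int n" using q(2) by simp
  then have "card {i \<in> {1..s}. \<not> q dvd m i} + 1 < card {1..n}" by simp
  from large_group_of_power_relators[OF _ _ assms(2-4) q(1) this] show ?thesis by simp
qed

end
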